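(* For $\mathcal T\in\mathbb T$, $(u,w)\in\breve{\mathbb U}^\delta_{\mathcal T}$, $f\in\mathbb F^\delta_{\mathcal T}$ and $K'\in\mathcal T$, with $R^\delta_K$ denoting the restriction to $K$ of $R^\delta_{\mathcal T_s}(u,w;f)$, we have $$\sum_{K\in\mathcal T_s(K')}\Big(\|R^\delta_K-(\partial_{\mathbf b}w+cu-f)\|^2_{L_2(K)}+\|\partial_{\mathbf b}R^\delta_K-(w-u)\|^2_{L_2(K)}\Big)\lesssim\sigma^2\,\eta^2_{K'}(u,w;f),$$ and $$\Big|\,\|R^\delta_{\mathcal T_s(K')}(u,w;f)\|^2_{H(\mathbf b;\mathcal T_s(K'))}-\eta^2_{K'}(u,w;f)\Big|\lesssim\sigma\,\eta^2_{K'}(u,w;f),$$ where the constants hidden in $\lesssim$ depend only on the involved polynomial degrees, and on (upper bounds for) $|\mathbf b|^{-1}$, $\|c\|_{L_\infty(K')}$ and $\varrho$.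
   Context: $\Omega\subset\mathbb R^n$ is a bounded polytopal domain, $\mathbf b\in\mathbb R^n\setminus\{0\}$ is constant, $\partial_{\mathbf b}:=\mathbf b\cdot\nabla$. $\Gamma_-$ is the closure of the set of points of $\partial\Omega$ at which the outward unit normal $\mathbf n$ is defined and $\mathbf n\cdot\mathbf b<0$. $H(\mathbf b;\Omega):=\{u\in L_2(\Omega):\partial_{\mathbf b}u\in L_2(\Omega)\}$ with the graph norm; $H_{0,\Gamma_-}(\mathbf b;\Omega)$ is the closure in it of smooth functions vanishing on $\Gamma_-$. It is assumed that $w\mapsto\partial_{\mathbf b}w+cw$ is a linear isomorphism from $H_{0,\Gamma_-}(\mathbf b;\Omega)$ onto $L_2(\Omega)$. $\mathbb T$ is a family of partitions of $\bar\Omega$ into essentially disjoint closed $n$-simplices, all obtained from an initial partition $\mathcal T_\bot$ by repeated application to individual simplices of a refinement rule splitting a simplex into 2 or more subsimplices, and uniformly shape regular: $\varrho:=\sup_K\operatorname{diam}(K)/\sup\{\operatorname{diam}(B):B\text{ a ball in }K\}<\infty$. The coefficient $c$ is constant on each cell of $\mathcal T_\bot$. To each $\mathcal T\in\mathbb T$ a refinement $\mathcal T_s\in\mathbb T$ is assigned; $\sigma:=\sup_{\mathcal T\in\mathbb T}\max_{K'\in\mathcal T}\max\big(\max_{\{K\in\mathcal T_s:K\subset K'\}}\frac{\operatorname{diam}(K)}{\operatorname{diam}(K')},\operatorname{diam}(K')\big)$, and $\inf_{\mathcal T}\min_{K'\in\mathcal T}\min_{\{K\in\mathcal T_s:K\subset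 K'\}}\frac{\operatorname{diam}(K)}{\operatorname{diam}(K')}\gtrsim\sigma$. $\mathcal T_s(K'):=\{K\in\mathcal T_s:K\subset K'\}$. Degrees: $m_w\ge1$, $m_u,m_f\ge0$, $m_v\ge\max(m_w+1,m_u+1,m_f)$. $\breve{\mathbb U}^\delta_{\mathcal T}:=\prod_{K'\in\mathcal T}\mathcal P_{m_u}(K')\times\big(H_{0,\Gamma_-}(\mathbf b;\Omega)\cap\prod_{K'\in\mathcal T}\mathcal P_{m_w}(K')\big)$, $\mathbb F^\delta_{\mathcal T}:=\prod_{K'\in\mathcal T}\mathcal P_{m_f}(K')$, $\bar{\mathbb V}^\delta_{\mathcal T_s}:=\prod_{K\in\mathcal T_s}\mathcal P_{m_v}(K)$. For a collection $\mathcal S$ of simplices, $\|v\|^2_{H(\mathbf b;\mathcal S)}:=\sum_{K\in\mathcal S}\|v\|^2_{L_2(K)}+\|\partial_{\mathbf b}v\|^2_{L_2(K)}$. $R^\delta_{\mathcal T_s}=R^\delta_{\mathcal T_s}(u,w;f)\in\bar{\mathbb V}^\delta_{\mathcal T_s}$ is defined by $$\langle R^\delta_{\mathcal T_s},v\rangle_{H(\mathbf b;\mathcal T_s)}=\sum_{K\in\mathcal T_s}\int_K(cu+\partial_{\mathbf b}w)v+(w-u)\partial_{\mathbf b}v\,d\mathbf x-\int_\Omega fv\,d\mathbf x\qquad(v\in\bar{\mathbb V}^\delta_{\mathcal T_s}),$$ and $R^\delta_{\mathcal T_s(K')}$ is its restriction to the cells of $\mathcal T_s(K')$. $\eta^2_{K'}(u,w;f):=\|u-w\|^2_{L_2(K')}+\|\partial_{\mathbf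 b}w+cu-f\|^2_{L_2(K')}$. *)

theory Defs
  imports "HOL-Analysis.Analysis" "HOL-Probability.Essential_Supremum"
begin

section \<open>Function spaces\<close>

text \<open>
  Elements of \<open>L\<^sub>2(S)\<close> are represented by functions on the whole space; two functions that agree
  almost everywhere on \<open>S\<close> represent the same element.
\<close>

definition L2 :: "(real ^ 'n) set \<Rightarrow> (real ^ 'n \<Rightarrow> real) set" where
  "L2 S = {f \<in> borel_measurable (lebesgue_on S). integrable (lebesgue_on S) (\<lambda>x. (f x)\<^sup>2)}"

definition L2norm :: "(real ^ 'n) set \<Rightarrow> (real ^ 'n \<Rightarrow> real) \<Rightarrow> real" where
  "L2norm S f = sqrt (LINT x|lebesgue_on S. (f x)\<^sup>2)"

text \<open>
  The classical derivative \<open>\<partial>\<^sub>b v = b \<bullet> \<nabla>v\<close>. It is used for smooth functions and for piecewise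
  polynomials; for the latter it is meaningful in the interiors of the cells, hence almost
  everywhere on every cell.
\<close>

definition dderiv :: "real ^ 'n \<Rightarrow> (real ^ 'n \<Rightarrow> real) \<Rightarrow> real ^ 'n \<Rightarrow> real" where
  "dderiv b v x = frechet_derivative v (at x) b"

primrec Ck :: "nat \<Rightarrow> (real ^ 'n \<Rightarrow> real) \<Rightarrow> bool" where
  "Ck 0 f \<longleftrightarrow> continuous_on UNIV f"
| "Ck (Suc k) f \<longleftrightarrow> (\<forall>x. f differentiable (at x)) \<and> (\<forall>v. Ck k (dderiv v f))"

definition smooth :: "(real ^ 'n \<Rightarrow> real) \<Rightarrow> bool" where
  "smooth f \<longleftrightarrow> (\<forall>k. Ck k f)"

definition test_function :: "(real ^ 'n) set \<Rightarrow> (real ^ 'n \<Rightarrow> real) \<Rightarrow> bool" where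
  "test_function \<Omega> \<phi> \<longleftrightarrow>
     smooth \<phi> \<and> compact (closure {x. \<phi> x \<noteq> 0}) \<and> closure {x. \<phi> x \<noteq> 0} \<subseteq> \<Omega>"

definition weak_dderiv ::
  "real ^ 'n \<Rightarrow> (real ^ 'n) set \<Rightarrow> (real ^ 'n \<Rightarrow> real) \<Rightarrow> (real ^ 'n \<Rightarrow> real) \<Rightarrow> bool" where
  "weak_dderiv b \<Omega> u g \<longleftrightarrow>
     (\<forall>\<phi>. test_function \<Omega> \<phi> \<longrightarrow>
        (LINT x|lebesgue_on \<Omega>. u x * dderiv b \<phi> x) = - (LINT x|lebesgue_on \<Omega>. g x * \<phi> x))"

definition Hb :: "real ^ 'n \<Rightarrow> (real ^ 'n) set \<Rightarrow> (real ^ 'n \<Rightarrow> real) set" where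
  "Hb b \<Omega> = {u \<in> L2 \<Omega>. \<exists>g \<in> L2 \<Omega>. weak_dderiv b \<Omega> u g}"

text \<open>The weak derivative of \<open>u \<in> Hb b \<Omega>\<close>; it is unique up to a null set.\<close>

definition wderiv :: "real ^ 'n \<Rightarrow> (real ^ 'n) set \<Rightarrow> (real ^ 'n \<Rightarrow> real) \<Rightarrow> real ^ 'n \<Rightarrow> real" where
  "wderiv b \<Omega> u = (SOME g. g \<in> L2 \<Omega> \<and> weak_dderiv b \<Omega> u g)"

definition Hb_norm :: "real ^ 'n \<Rightarrow> (real ^ 'n) set \<Rightarrow> (real ^ 'n \<Rightarrow> real) \<Rightarrow> real" where
  "Hb_norm b \<Omega> u = sqrt ((L2norm \<Omega> u)\<^sup>2 + (L2norm \<Omega> (wderiv b \<Omega> u))\<^sup>2)"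


section \<open>The domain and the transport problem\<close>

definition polytopal_domain :: "(real ^ 'n) set \<Rightarrow> bool" where
  "polytopal_domain \<Omega> \<longleftrightarrow>
     \<Omega> \<noteq> {} \<and> connected \<Omega> \<and> (\<exists>F. finite F \<and> (\<forall>P\<in>F. polytope P) \<and> \<Omega> = interior (\<Union>F))"

text \<open>
  The boundary of a polytopal domain is piecewise flat, so that it has a normal at a point
  exactly if near this point the domain is a half space.
\<close>

definition outward_unit_normal :: "(real ^ 'n) set \<Rightarrow> real ^ 'n \<Rightarrow> real ^ 'n \<Rightarrow> bool" where
  "outward_unit_normal \<Omega> x \<nu> \<longleftrightarrow>
     x \<in> frontier \<Omega> \<and> norm \<nu> = 1 \<and>
     (\<exists>\<epsilon>>0. \<Omega> \<inter> ball x \<epsilon> = {y \<in> ball x \<epsilon>. (y - x) \<bullet> \<nu> < 0})"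

definition inflow :: "real ^ 'n \<Rightarrow> (real ^ 'n) set \<Rightarrow> (real ^ 'n) set" where
  "inflow b \<Omega> = closure {x. \<exists>\<nu>. outward_unit_normal \<Omega> x \<nu> \<and> \<nu> \<bullet> b < 0}"

definition H0 :: "real ^ 'n \<Rightarrow> (real ^ 'n) set \<Rightarrow> (real ^ 'n \<Rightarrow> real) set" where
  "H0 b \<Omega> = {u \<in> Hb b \<Omega>. \<forall>\<epsilon>>0. \<exists>\<phi>. smooth \<phi> \<and> (\<forall>x \<in> inflow b \<Omega>. \<phi> x = 0) \<and>
                 Hb_norm b \<Omega> (\<lambda>x. u x - \<phi> x) < \<epsilon>}"

text \<open>
  The map \<open>w \<mapsto> \<partial>\<^sub>b w + c w\<close> from \<open>H0 b \<Omega>\<close> to \<open>L2 \<Omega>\<close> is linear; it is an isomorphism if it is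
  bounded, surjective, and bounded from below (i.e. injective with bounded inverse).
\<close>

definition transport_isomorphism ::
  "real ^ 'n \<Rightarrow> (real ^ 'n \<Rightarrow> real) \<Rightarrow> (real ^ 'n) set \<Rightarrow> bool" where
  "transport_isomorphism b c \<Omega> \<longleftrightarrow>
     (\<forall>w \<in> H0 b \<Omega>. (\<lambda>x. wderiv b \<Omega> w x + c x * w x) \<in> L2 \<Omega>) \<and>
     (\<forall>g \<in> L2 \<Omega>. \<exists>w \<in> H0 b \<Omega>. AE x in lebesgue_on \<Omega>. wderiv b \<Omega> w x + c x * w x = g x) \<and>
     (\<exists>M. \<forall>w \<in> H0 b \<Omega>. L2norm \<Omega> (\<lambda>x. wderiv b \<Omega> w x + c x * w x) \<le> M * Hb_norm b \<Omega> w) \<and>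
     (\<exists>M. \<forall>w \<in> H0 b \<Omega>. Hb_norm b \<Omega> w \<le> M * L2norm \<Omega> (\<lambda>x. wderiv b \<Omega> w x + c x * w x))"


section \<open>Partitions\<close>

definition simplicial_partition :: "(real ^ 'n) set set \<Rightarrow> (real ^ 'n) set \<Rightarrow> bool" where
  "simplicial_partition T S \<longleftrightarrow>
     finite T \<and> (\<forall>K\<in>T. int CARD('n) simplex K) \<and>
     (\<forall>K\<in>T. \<forall>L\<in>T. K \<noteq> L \<longrightarrow> interior K \<inter> interior L = {}) \<and> \<Union>T = S"

definition refinement_rule :: "((real ^ 'n) set \<Rightarrow> (real ^ 'n) set set) \<Rightarrow> bool" where
  "refinement_rule split \<longleftrightarrow>
     (\<forall>K. int CARD('n) simplex K \<longrightarrow> simplicial_partition (split K) K \<and> 2 \<le> card (split K))"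

inductive_set refinements ::
  "((real ^ 'n) set \<Rightarrow> (real ^ 'n) set set) \<Rightarrow> (real ^ 'n) set set \<Rightarrow> (real ^ 'n) set set set"
  for split :: "(real ^ 'n) set \<Rightarrow> (real ^ 'n) set set" and T0 :: "(real ^ 'n) set set" where
  init: "T0 \<in> refinements split T0"
| step: "T \<in> refinements split T0 \<Longrightarrow> K \<in> T \<Longrightarrow> (T - {K}) \<union> split K \<in> refinements split T0"

definition shape_ratio :: "(real ^ 'n) set \<Rightarrow> real" where
  "shape_ratio K = diameter K / Sup {diameter (ball x r) |x r. ball x r \<subseteq> K}"

text \<open>The shape regularity constant \<open>\<rho>\<close>; meaningful if \<open>shape_ratio\<close> is bounded on all cells.\<close>

definition shape_const :: "(real ^ 'n) set set set \<Rightarrow> real" where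
  "shape_const TT = (SUP K \<in> \<Union>TT. shape_ratio K)"

definition cells_in :: "(real ^ 'n) set set \<Rightarrow> (real ^ 'n) set \<Rightarrow> (real ^ 'n) set set" where
  "cells_in S K' = {K \<in> S. K \<subseteq> K'}"

definition subgrid_sigma ::
  "(real ^ 'n) set set set \<Rightarrow> ((real ^ 'n) set set \<Rightarrow> (real ^ 'n) set set) \<Rightarrow> real" where
  "subgrid_sigma TT s = (SUP T\<in>TT. MAX K'\<in>T.
     max (MAX K\<in>cells_in (s T) K'. diameter K / diameter K') (diameter K'))"

definition min_subgrid_ratio ::
  "(real ^ 'n) set set set \<Rightarrow> ((real ^ 'n) set set \<Rightarrow> (real ^ 'n) set set) \<Rightarrow> real" where
  "min_subgrid_ratio TT s = (INF T\<in>TT. MIN K'\<in>T. MIN K\<in>cells_in (s T) K'. diameter K / diameter K')"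

text \<open>
  \<open>T0\<close> is the initial partition, \<open>split\<close> the refinement rule, \<open>TT\<close> the family of partitions, and
  \<open>s\<close> the map that assigns to a partition \<open>T\<close> its refinement \<open>T\<^sub>s\<close>.
\<close>

locale transport_dpg =
  fixes \<Omega> :: "(real ^ 'n) set" and b :: "real ^ 'n" and c :: "real ^ 'n \<Rightarrow> real"
    and T0 :: "(real ^ 'n) set set" and split :: "(real ^ 'n) set \<Rightarrow> (real ^ 'n) set set"
    and TT :: "(real ^ 'n) set set set" and s :: "(real ^ 'n) set set \<Rightarrow> (real ^ 'n) set set"
  assumes domain: "polytopal_domain \<Omega>"
    and b_nonzero: "b \<noteq> 0"
    and isomorphism: "transport_isomorphism b c \<Omega>"
    and initial_partition: "simplicial_partition T0 (closure \<Omega>)"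
    and rule: "refinement_rule split"
    and family: "TT \<subseteq> refinements split T0"
    and shape_regular: "bdd_above (shape_ratio ` \<Union>TT)"
    and c_piecewise_constant: "\<forall>K\<in>T0. \<exists>a. \<forall>x \<in> interior K. c x = a"
    and subgrid: "\<forall>T\<in>TT. s T \<in> TT \<and> s T \<in> refinements split T"
    and subgrid_ratio: "\<exists>\<kappa>>0. min_subgrid_ratio TT s \<ge> \<kappa> * subgrid_sigma TT s"


section \<open>Discrete spaces, residual and estimator\<close>

text \<open>Polynomials in \<open>n\<close> variables of total degree at most \<open>m\<close>.\<close>

definition polys :: "nat \<Rightarrow> (real ^ 'n \<Rightarrow> real) set" where
  "polys m = {p. \<exists>a. \<forall>x. p x =
     (\<Sum>\<alpha> | (\<Sum>i\<in>UNIV. \<alpha> i) \<le> m. a \<alpha> * (\<Prod>i\<in>UNIV. (x $ i) ^ (\<alpha> :: 'n \<Rightarrow> nat) i))}"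

text \<open>
  The space \<open>\<Prod>\<^bsub>K\<in>T\<^esub> P\<^sub>m(K)\<close>. Its elements are multi-valued on the boundaries of the cells, which
  are null sets; the values there are left arbitrary.
\<close>

definition broken_polys :: "nat \<Rightarrow> (real ^ 'n) set set \<Rightarrow> (real ^ 'n \<Rightarrow> real) set" where
  "broken_polys m T = {v. \<forall>K\<in>T. \<exists>p \<in> polys m. \<forall>x \<in> interior K. v x = p x}"

definition trial_space ::
  "nat \<Rightarrow> nat \<Rightarrow> real ^ 'n \<Rightarrow> (real ^ 'n) set \<Rightarrow> (real ^ 'n) set set \<Rightarrow>
     ((real ^ 'n \<Rightarrow> real) \<times> (real ^ 'n \<Rightarrow> real)) set" where
  "trial_space mu mw b \<Omega> T = broken_polys mu T \<times> (H0 b \<Omega> \<inter> broken_polys mw T)"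

definition broken_inner ::
  "real ^ 'n \<Rightarrow> (real ^ 'n) set set \<Rightarrow> (real ^ 'n \<Rightarrow> real) \<Rightarrow> (real ^ 'n \<Rightarrow> real) \<Rightarrow> real" where
  "broken_inner b S r v =
     (\<Sum>K\<in>S. (LINT x|lebesgue_on K. r x * v x) + (LINT x|lebesgue_on K. dderiv b r x * dderiv b v x))"

definition broken_norm :: "real ^ 'n \<Rightarrow> (real ^ 'n) set set \<Rightarrow> (real ^ 'n \<Rightarrow> real) \<Rightarrow> real" where
  "broken_norm b S v = sqrt (\<Sum>K\<in>S. (L2norm K v)\<^sup>2 + (L2norm K (dderiv b v))\<^sup>2)"

text \<open>\<open>R\<close> is the lifted residual in the space of broken polynomials of degree \<open>mv\<close> on \<open>S\<close>.\<close>

definition lifted_residual ::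
  "nat \<Rightarrow> real ^ 'n \<Rightarrow> (real ^ 'n \<Rightarrow> real) \<Rightarrow> (real ^ 'n) set \<Rightarrow> (real ^ 'n) set set \<Rightarrow>
   (real ^ 'n \<Rightarrow> real) \<Rightarrow> (real ^ 'n \<Rightarrow> real) \<Rightarrow> (real ^ 'n \<Rightarrow> real) \<Rightarrow> (real ^ 'n \<Rightarrow> real) \<Rightarrow> bool" where
  "lifted_residual mv b c \<Omega> S u w f R \<longleftrightarrow>
     R \<in> broken_polys mv S \<and>
     (\<forall>v \<in> broken_polys mv S. broken_inner b S R v =
        (\<Sum>K\<in>S. LINT x|lebesgue_on K.
           (c x * u x + dderiv b w x) * v x + (w x - u x) * dderiv b v x)
        - (LINT x|lebesgue_on \<Omega>. f x * v x))"

definition estimator ::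
  "real ^ 'n \<Rightarrow> (real ^ 'n \<Rightarrow> real) \<Rightarrow> (real ^ 'n) set \<Rightarrow>
   (real ^ 'n \<Rightarrow> real) \<Rightarrow> (real ^ 'n \<Rightarrow> real) \<Rightarrow> (real ^ 'n \<Rightarrow> real) \<Rightarrow> real" where
  "estimator b c K' u w f =
     sqrt ((L2norm K' (\<lambda>x. u x - w x))\<^sup>2 + (L2norm K' (\<lambda>x. dderiv b w x + c x * u x - f x))\<^sup>2)"

end

theory Submission
  imports Defs
begin

text \<open>
  On a cell \<open>K\<close> of the subgrid the lifted residual is the best approximation \<open>(R, \<partial>\<^sub>b R)\<close> of
  the polynomial pair \<open>(g, h) = (\<partial>\<^sub>b w + c u - f, w - u)\<close> in \<open>L\<^sub>2(K) \<times> L\<^sub>2(K)\<close>. As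
  \<open>deg h < mv\<close>, there is a competitor \<open>v = g(y) + P\<close> with \<open>y \<in> K\<close> and \<open>\<partial>\<^sub>b P = h\<close> exactly, so
  that only \<open>\<parallel>v - g\<parallel>\<close> remains. Inverse estimates on the macro cell \<open>K'\<close> bound the oscillation of
  \<open>g\<close> on \<open>K\<close> by \<open>diam K / diam K'\<close> and \<open>P\<close> by \<open>diam K' / \<bar>b\<bar>\<close>, relative to the size of
  \<open>(g, h)\<close> on \<open>K'\<close>; both factors are at most a multiple of \<open>\<sigma>\<close>. The second estimate follows
  because by Pythagoras its left-hand side is the squared error of the first one, which is also
  at most \<open>\<eta>\<^sup>2\<close>.
\<close>

section \<open>Polynomials of bounded total degree\<close>

text \<open>All constants must be uniform over cells and data. Instead of a reference simplex, the
  inverse estimates use any measurable set between two concentric balls whose radii have bounded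
  ratio. Translation and scaling to the unit ball then suffice, and shape regularity enters only
  through a ball inscribed in \<open>K'\<close>. They are applied on \<open>K'\<close>, never on the
  subcells: there g and h are single polynomials, because c is constant on the initial cell that
  contains \<open>K'\<close>. Maximum norms mediate between \<open>K'\<close> and K. The local error
  is at most |K| W with one W for all K, the measures |K| add up to |K'|, and |K'| times a squared
  maximum is bounded by a squared L2 norm on \<open>K'\<close>. So the number of subcells does not
  enter. The antiderivative P can be exact because the derivatives of h along b eventually vanish.
  Each of them costs a factor |b| / diam K' and each integration gains the inverse factor, so that a
  single diam K' / |b| is left over. Functions of the broken spaces, and hence their pointwise
  derivatives, are arbitrary on cell boundaries. Integrals are therefore first transferred to
  polynomials that agree in the interior.\<close>

definition multi_indices :: "nat \<Rightarrow> ('n :: finite \<Rightarrow> nat) set" where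
  "multi_indices m = {\<alpha>. (\<Sum>i\<in>UNIV. \<alpha> i) \<le> m}"

definition monomial :: "('n :: finite \<Rightarrow> nat) \<Rightarrow> real ^ 'n \<Rightarrow> real" where
  "monomial \<alpha> x = (\<Prod>i\<in>UNIV. (x $ i) ^ \<alpha> i)"

lemma finite_multi_indices [simp]: "finite (multi_indices m :: ('n :: finite \<Rightarrow> nat) set)"
proof (rule finite_subset)
  show "(multi_indices m :: ('n \<Rightarrow> nat) set) \<subseteq> (\<Pi>\<^sub>E i\<in>UNIV. {..m})"
  proof
    fix \<alpha> :: "'n \<Rightarrow> nat" assume "\<alpha> \<in> multi_indices m"
    then have "(\<Sum>i\<in>UNIV. \<alpha> i) \<le> m" by (simp add: multi_indices_def)
    moreover have "\<alpha> i \<le> (\<Sum>i\<in>UNIV. \<alpha> i)" for i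
      by (rule member_le_sum) auto
    ultimately show "\<alpha> \<in> (\<Pi>\<^sub>E i\<in>UNIV. {..m})" by (auto intro: order_trans)
  qed
qed (auto intro: finite_PiE)

lemma polys_eq: "polys m = {p. \<exists>a. \<forall>x. p x = (\<Sum>\<alpha>\<in>multi_indices m. a \<alpha> * monomial \<alpha> x)}"
  by (simp add: polys_def multi_indices_def monomial_def)

lemma polys_monomial: "\<alpha> \<in> multi_indices m \<Longrightarrow> monomial \<alpha> \<in> polys m"
  unfolding polys_eq
  by (auto intro!: exI[of _ "\<lambda>\<beta>. of_bool (\<beta> = \<alpha>)"])

lemma polys_add: "p \<in> polys m \<Longrightarrow> q \<in> polys m \<Longrightarrow> (\<lambda>x. p x + q x) \<in> polys m"
  unfolding polys_eq
proof safe
  fix a a' assume "\<forall>x. p x = (\<Sum>\<alpha>\<in>multi_indices m. a \<alpha> * monomial \<alpha> x)"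
    "\<forall>x. q x = (\<Sum>\<alpha>\<in>multi_indices m. a' \<alpha> * monomial \<alpha> x)"
  then show "\<exists>c. \<forall>x. p x + q x = (\<Sum>\<alpha>\<in>multi_indices m. c \<alpha> * monomial \<alpha> x)"
    by (intro exI[of _ "\<lambda>\<alpha>. a \<alpha> + a' \<alpha>"]) (simp add: sum.distrib distrib_right)
qed

lemma polys_cmult: "p \<in> polys m \<Longrightarrow> (\<lambda>x. c * p x) \<in> polys m"
  unfolding polys_eq
proof safe
  fix a assume "\<forall>x. p x = (\<Sum>\<alpha>\<in>multi_indices m. a \<alpha> * monomial \<alpha> x)"
  then show "\<exists>a. \<forall>x. c * p x = (\<Sum>\<alpha>\<in>multi_indices m. a \<alpha> * monomial \<alpha> x)"
    by (intro exI[of _ "\<lambda>\<alpha>. c * a \<alpha>"]) (simp add: sum_distrib_left mult.assoc)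
qed

lemma polys_const: "(\<lambda>x. c) \<in> polys m"
proof -
  have "(\<lambda>x :: real ^ 'n. c * monomial (\<lambda>_. 0) x) \<in> polys m"
    by (intro polys_cmult polys_monomial) (simp add: multi_indices_def)
  then show ?thesis by (simp add: monomial_def)
qed

lemma polys_sum: "(\<And>i. i \<in> I \<Longrightarrow> p i \<in> polys m) \<Longrightarrow> (\<lambda>x. \<Sum>i\<in>I. p i x) \<in> polys m"
  by (induction I rule: infinite_finite_induct) (auto intro: polys_const polys_add)

lemma polys_diff: "p \<in> polys m \<Longrightarrow> q \<in> polys m \<Longrightarrow> (\<lambda>x. p x - q x) \<in> polys m"
  using polys_add[OF _ polys_cmult[of q m "-1"], of p] by simp

lemma polysE:
  assumes "p \<in> polys m"
  obtains a where "p = (\<lambda>x. \<Sum>\<alpha>\<in>multi_indices m. a \<alpha> * monomial \<alpha> x)"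
  using assms unfolding polys_eq by auto

lemma monomial_fun_upd: "monomial (\<alpha>(j := Suc (\<alpha> j))) x = x $ j * monomial \<alpha> x"
proof -
  have "(\<Prod>i\<in>UNIV - {j}. (x $ i) ^ (\<alpha>(j := Suc (\<alpha> j))) i) = (\<Prod>i\<in>UNIV - {j}. (x $ i) ^ \<alpha> i)"
    by (rule prod.cong) auto
  then show ?thesis
    by (simp add: monomial_def prod.remove[of UNIV j] del: fun_upd_apply) simp
qed

lemma sum_fun_upd_Suc: "(\<Sum>i\<in>UNIV. (\<alpha>(j := Suc (\<alpha> j))) i) = Suc (\<Sum>i\<in>(UNIV :: 'n :: finite set). \<alpha> i)"
proof -
  have "(\<Sum>i\<in>UNIV - {j}. (\<alpha>(j := Suc (\<alpha> j))) i) = (\<Sum>i\<in>UNIV - {j}. \<alpha> i)"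
    by (rule sum.cong) auto
  then show ?thesis
    by (simp add: sum.remove[of UNIV j] del: fun_upd_apply) simp
qed

lemma polys_coord_mult:
  assumes "p \<in> polys m"
  shows "(\<lambda>x. x $ j * p x) \<in> polys (Suc m)"
proof -
  obtain a where p: "p = (\<lambda>x. \<Sum>\<alpha>\<in>multi_indices m. a \<alpha> * monomial \<alpha> x)"
    using assms by (rule polysE)
  have "(\<lambda>x. \<Sum>\<alpha>\<in>multi_indices m. a \<alpha> * monomial (\<alpha>(j := Suc (\<alpha> j))) x) \<in> polys (Suc m)"
    by (intro polys_sum polys_cmult polys_monomial)
      (simp add: multi_indices_def sum_fun_upd_Suc del: fun_upd_apply)
  then show ?thesis
    unfolding p by (simp add: monomial_fun_upd sum_distrib_left algebra_simps)
qed

text \<open>A monomial of positive degree is a coordinate times a monomial of degree one less. The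
  rule carries the degree bound along, so later facts about products, substitutions and derivatives
  never touch coefficients. \<open>const\<close> is asked for every bound m because
  \<open>add\<close> joins polynomials under the same bound.\<close>

lemma polys_induct [consumes 1, case_names const add coord]:
  assumes "p \<in> polys m"
    and const: "\<And>m c. P m (\<lambda>x. c)"
    and add: "\<And>m p q. p \<in> polys m \<Longrightarrow> q \<in> polys m \<Longrightarrow> P m p \<Longrightarrow> P m q \<Longrightarrow> P m (\<lambda>x. p x + q x)"
    and coord: "\<And>m p j. p \<in> polys m \<Longrightarrow> P m p \<Longrightarrow> P (Suc m) (\<lambda>x. x $ j * p x)"
  shows "P m p"
proof -
  have mono: "P m (\<lambda>x. c * monomial \<alpha> x)" if "\<alpha> \<in> multi_indices m" for \<alpha> m c
    using that
  proof (induction "\<Sum>i\<in>UNIV. \<alpha> i" arbitrary: \<alpha> m)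
    case 0
    then have "monomial \<alpha> = (\<lambda>x. 1)" by (auto simp: monomial_def)
    then show ?case using const by simp
  next
    case (Suc k)
    then obtain j where j: "\<alpha> j > 0"
      by (metis nat.distinct(1) not_gr_zero sum.neutral)
    define \<beta> where "\<beta> = \<alpha>(j := \<alpha> j - 1)"
    have \<alpha>: "\<alpha> = \<beta>(j := Suc (\<beta> j))" using j by (auto simp: \<beta>_def)
    have k: "k = (\<Sum>i\<in>UNIV. \<beta> i)" using Suc(2) sum_fun_upd_Suc[where \<alpha> = \<beta> and j = j] \<alpha> by simp
    obtain m' where m': "m = Suc m'" using Suc by (cases m) (auto simp: multi_indices_def)
    have \<beta>: "\<beta> \<in> multi_indices m'" using k Suc m' by (auto simp: multi_indices_def)
    have "P (Suc m') (\<lambda>x. x $ j * (c * monomial \<beta> x))"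
      using Suc(1)[OF k \<beta>] \<beta> by (intro coord polys_cmult polys_monomial)
    then show ?case
      unfolding m' \<alpha> monomial_fun_upd by (simp add: mult.left_commute)
  qed
  obtain a where p: "p = (\<lambda>x. \<Sum>\<alpha>\<in>multi_indices m. a \<alpha> * monomial \<alpha> x)"
    using assms(1) by (rule polysE)
  have "P m (\<lambda>x. \<Sum>\<alpha>\<in>A. a \<alpha> * monomial \<alpha> x)" if "finite A" "A \<subseteq> multi_indices m" for A
    using that
  proof (induction A)
    case (insert \<alpha> A)
    then have "P m (\<lambda>x. a \<alpha> * monomial \<alpha> x + (\<Sum>\<alpha>\<in>A. a \<alpha> * monomial \<alpha> x))"
      by (intro add polys_cmult polys_sum polys_monomial mono) auto
    with insert show ?case by simp
  qed (simp add: const)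
  then show ?thesis unfolding p by simp
qed

lemma polys_Suc: "p \<in> polys m \<Longrightarrow> p \<in> polys (Suc m)"
  by (induction rule: polys_induct) (auto intro: polys_const polys_add polys_coord_mult)

lemma polys_le: "p \<in> polys m \<Longrightarrow> m \<le> k \<Longrightarrow> p \<in> polys k"
  by (induction k) (auto simp: le_Suc_eq intro: polys_Suc)

lemma polys_mult: "p \<in> polys m \<Longrightarrow> q \<in> polys k \<Longrightarrow> (\<lambda>x. p x * q x) \<in> polys (m + k)"
proof (induction rule: polys_induct)
  case (const m c)
  then show ?case by (intro polys_cmult) (auto elim: polys_le)
next
  case (coord m p j)
  then show ?case using polys_coord_mult[of "\<lambda>x. p x * q x" "m + k" j] by (simp add: mult.assoc)
qed (auto simp: distrib_right intro: polys_add)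

lemma polys_power: "p \<in> polys m \<Longrightarrow> (\<lambda>x. p x ^ k) \<in> polys (k * m)"
  by (induction k) (auto intro: polys_const polys_mult)

lemma polys_inner_diff:
  fixes x0 b :: "real ^ 'n"
  shows "(\<lambda>x. (x - x0) \<bullet> b) \<in> polys 1"
proof -
  have "(\<lambda>x :: real ^ 'n. x $ i) \<in> polys 1" for i
    using polys_coord_mult[OF polys_const, of i 1 0] by simp
  then have "(\<lambda>x. (\<Sum>i\<in>UNIV. b $ i * x $ i) - x0 \<bullet> b) \<in> polys 1"
    by (intro polys_diff polys_sum polys_cmult polys_const)
  then show ?thesis
    by (simp add: inner_diff_left inner_vec_def sum_subtractf algebra_simps)
qed

text \<open>Only translations and dilations are needed to move to the unit ball, and these turn the
  coordinate j into \<open>x0 $ j + r * y $ j\<close>.\<close>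

lemma polys_affine: "p \<in> polys m \<Longrightarrow> (\<lambda>y. p (x0 + r *\<^sub>R y)) \<in> polys m"
proof (induction rule: polys_induct)
  case (coord m p j)
  let ?q = "\<lambda>y. p (x0 + r *\<^sub>R y)"
  have "(\<lambda>y. x0 $ j * ?q y + r * (y $ j * ?q y)) \<in> polys (Suc m)"
    by (intro polys_add polys_cmult polys_coord_mult coord polys_Suc)
  then show ?case by (simp add: algebra_simps)
qed (auto intro: polys_const polys_add)

lemma polys_differentiable: "p \<in> polys m \<Longrightarrow> p differentiable (at x)"
proof (induction rule: polys_induct)
  case (coord m p j)
  have "(\<lambda>x. x $ j :: real) differentiable (at x)"
    by (intro bounded_linear_imp_differentiable bounded_linear_vec_nth)
  with coord show ?case by (intro differentiable_mult)
qed auto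

lemma polys_continuous: "p \<in> polys m \<Longrightarrow> continuous_on S p"
  by (meson continuous_at_imp_continuous_on differentiable_imp_continuous_within polys_differentiable)

section \<open>Directional derivatives of polynomials\<close>

lemma dderiv_eqI: "(f has_derivative f') (at x) \<Longrightarrow> dderiv b f x = f' b"
  unfolding dderiv_def by (metis frechet_derivative_at)

lemma dderiv_has_derivative:
  "f differentiable (at x) \<Longrightarrow> (f has_derivative (\<lambda>b. dderiv b f x)) (at x)"
  unfolding dderiv_def by (metis frechet_derivative_works)

lemma dderiv_const: "dderiv b (\<lambda>x. c) x = 0"
  by (rule dderiv_eqI[THEN trans]) (auto intro!: derivative_eq_intros)

lemma dderiv_add:
  "f differentiable (at x) \<Longrightarrow> g differentiable (at x) \<Longrightarrow>
   dderiv b (\<lambda>x. f x + g x) x = dderiv b f x + dderiv b g x"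
  by (rule dderiv_eqI[THEN trans])
    (auto intro!: has_derivative_add dderiv_has_derivative)

lemma dderiv_diff:
  "f differentiable (at x) \<Longrightarrow> g differentiable (at x) \<Longrightarrow>
   dderiv b (\<lambda>x. f x - g x) x = dderiv b f x - dderiv b g x"
  by (rule dderiv_eqI[THEN trans])
    (auto intro!: has_derivative_diff dderiv_has_derivative)

lemma dderiv_mult:
  fixes f g :: "real ^ 'n \<Rightarrow> real"
  shows "f differentiable (at x) \<Longrightarrow> g differentiable (at x) \<Longrightarrow>
   dderiv b (\<lambda>x. f x * g x) x = f x * dderiv b g x + dderiv b f x * g x"
  by (rule dderiv_eqI[THEN trans])
    (auto intro!: has_derivative_mult dderiv_has_derivative)

lemma dderiv_cmult:
  "f differentiable (at x) \<Longrightarrow> dderiv b (\<lambda>x. c * f x) x = c * dderiv b f x"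
  by (simp add: dderiv_mult dderiv_const)

lemma dderiv_sum:
  "(\<And>i. i \<in> I \<Longrightarrow> f i differentiable (at x)) \<Longrightarrow>
   dderiv b (\<lambda>x. \<Sum>i\<in>I. f i x) x = (\<Sum>i\<in>I. dderiv b (f i) x)"
  by (rule dderiv_eqI[THEN trans])
    (auto intro!: has_derivative_sum dderiv_has_derivative)

lemma dderiv_coord: "dderiv b (\<lambda>x. x $ j) x = b $ j"
  by (rule dderiv_eqI[THEN trans])
    (auto intro: bounded_linear.has_derivative[OF bounded_linear_vec_nth])

lemma dderiv_inner_diff: "dderiv b (\<lambda>x. (x - x0) \<bullet> d) x = b \<bullet> d"
  by (rule dderiv_eqI[THEN trans]) (auto intro!: derivative_eq_intros)

text \<open>\<open>frechet_derivative\<close> is a choice among the derivatives at x, and f and g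
  have the same ones there. This covers broken polynomials, whose values off the open set are
  unknown.\<close>

lemma dderiv_cong_open:
  assumes "open S" "x \<in> S" "\<And>y. y \<in> S \<Longrightarrow> f y = g y"
  shows "dderiv b f x = dderiv b g x"
proof -
  have "(f has_derivative f') (at x) \<longleftrightarrow> (g has_derivative f') (at x)" for f'
    using assms has_derivative_transform_within_open[of f f' x UNIV S g]
      has_derivative_transform_within_open[of g f' x UNIV S f] by auto
  then show ?thesis by (simp add: dderiv_def frechet_derivative_def)
qed

lemma vec_nth_differentiable: "(\<lambda>x. x $ j :: real) differentiable (at x)"
  by (intro bounded_linear_imp_differentiable bounded_linear_vec_nth)

text \<open>Degrees are natural numbers, so \<open>m - 1\<close> stays 0 at m = 0 and the degree
  count alone cannot show that a derivative vanishes. This fact later ends the iterated integration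
  by parts.\<close>

lemma dderiv_polys_0:
  fixes p :: "real ^ 'n \<Rightarrow> real"
  assumes "p \<in> polys 0"
  shows "dderiv b p = (\<lambda>x. 0)"
proof -
  have "multi_indices 0 = {\<lambda>_ :: 'n. 0}" by (auto simp: multi_indices_def fun_eq_iff)
  then obtain a where "p = (\<lambda>x. a)"
    using assms by (auto elim!: polysE simp: monomial_def)
  then show ?thesis by (auto simp: dderiv_const)
qed

lemma dderiv_polys:
  fixes p :: "real ^ 'n \<Rightarrow> real"
  assumes "p \<in> polys m"
  shows "dderiv b p \<in> polys (m - 1)"
  using assms
proof (induction rule: polys_induct)
  case (const m c)
  have "dderiv b (\<lambda>x :: real ^ 'n. c) = (\<lambda>x. 0)" by (auto simp: dderiv_const)
  then show ?case by (simp add: polys_const)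
next
  case (add m p q)
  then have "dderiv b (\<lambda>x. p x + q x) = (\<lambda>x. dderiv b p x + dderiv b q x)"
    by (auto simp: dderiv_add polys_differentiable)
  then show ?case using add by (simp add: polys_add)
next
  case (coord m p j)
  then have *: "dderiv b (\<lambda>x. x $ j * p x) = (\<lambda>x. x $ j * dderiv b p x + b $ j * p x)"
    by (auto simp: dderiv_mult dderiv_coord polys_differentiable vec_nth_differentiable)
  have "(\<lambda>x. x $ j * dderiv b p x) \<in> polys m"
  \<comment> \<open>For m = 0 truncated subtraction would leave degree 1 for the product; there the
    derivative is zero instead.\<close>
  proof (cases m)
    case 0
    then have "dderiv b p = (\<lambda>x. 0)" using dderiv_polys_0 coord by blast
    then show ?thesis by (simp add: polys_const)
  next
    case (Suc k)
    then show ?thesis using polys_coord_mult[OF coord(2)] by simp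
  qed
  then show ?case unfolding * using coord by (auto intro: polys_add polys_cmult)
qed

section \<open>Inverse estimates\<close>

text \<open>Continuity on the whole space matters: S may be open, and f is integrable because it is
  so on a closed box around S.\<close>

lemma integrable_lebesgue_on_bounded:
  fixes f :: "real ^ 'n \<Rightarrow> real"
  assumes "bounded S" "S \<in> sets lebesgue" "continuous_on UNIV f"
  shows "integrable (lebesgue_on S) f"
proof -
  obtain a where "S \<subseteq> cbox (- a) a"
    using bounded_subset_cbox_symmetric[OF assms(1)] by blast
  moreover have "integrable (lebesgue_on (cbox (- a) a)) f"
    by (intro continuous_imp_integrable continuous_on_subset[OF assms(3)]) auto
  ultimately show ?thesis
    using set_integrable_subset[of lebesgue "cbox (- a) a" f S] assms(2)
    by (simp add: integrable_restrict_space set_integrable_def)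
qed

section \<open>Coefficients, values and derivatives against the L2 norm on the unit ball\<close>

lemma infinite_roots_imp_coeffs_0:
  fixes c :: "nat \<Rightarrow> real"
  assumes "\<epsilon> > 0" "\<And>t. \<bar>t\<bar> < \<epsilon> \<Longrightarrow> (\<Sum>i\<le>N. c i * t ^ i) = 0" "k \<le> N"
  shows "c k = 0"
proof (rule ccontr)
  assume "c k \<noteq> 0"
  then have "finite {x. (\<Sum>i\<le>N. c i * x ^ i) = 0}"
    using polyfun_finite_roots[of c N] assms(3) by blast
  moreover have "{-\<epsilon><..<\<epsilon>} \<subseteq> {x. (\<Sum>i\<le>N. c i * x ^ i) = 0}"
    using assms(2) by (auto simp: abs_less_iff)
  ultimately have "finite {-\<epsilon><..<\<epsilon>}" by (rule finite_subset[rotated])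
  then show False using assms(1) by (simp add: infinite_Ioo)
qed

text \<open>Induction on the variables in A. For fixed other coordinates the sum is a univariate
  polynomial in the new coordinate, so each group of exponents with equal entry j vanishes
  separately. Within a group the remaining coordinates still separate the exponents, which is the
  invariant stated in the third assumption. A cube is used rather than a ball since it allows one
  coordinate to vary freely.\<close>

lemma monomials_independent:
  fixes S :: "('n :: finite \<Rightarrow> nat) set" and A :: "'n set"
  assumes "finite A" "finite S"
    and "\<And>\<alpha> \<beta>. \<alpha> \<in> S \<Longrightarrow> \<beta> \<in> S \<Longrightarrow> \<forall>i\<in>A. \<alpha> i = \<beta> i \<Longrightarrow> \<alpha> = \<beta>"
    and "\<epsilon> > 0"
    and "\<And>x :: real ^ 'n. \<forall>i. \<bar>x $ i\<bar> < \<epsilon> \<Longrightarrow> (\<Sum>\<alpha>\<in>S. a \<alpha> * (\<Prod>i\<in>A. (x $ i) ^ \<alpha> i)) = 0"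
    and "\<alpha> \<in> S"
  shows "a \<alpha> = 0"
  using assms
proof (induction A arbitrary: S \<alpha> rule: finite_induct)
  case empty
  then have "S = {\<alpha>}" by blast
  then show ?case using empty(4)[of 0] empty(3) by simp
next
  case (insert j A)
  \<comment> \<open>Any common bound on the exponents of coordinate j would do.\<close>
  define N where "N = (\<Sum>\<beta>\<in>S. \<beta> j)"
  have N: "\<beta> j \<le> N" if "\<beta> \<in> S" for \<beta>
    unfolding N_def using that insert.prems(1) by (intro member_le_sum) auto
  let ?S = "\<lambda>k. {\<beta> \<in> S. \<beta> j = k}"
  show ?case
  proof (rule insert.IH[of "?S (\<alpha> j)" \<alpha>])
    fix x :: "real ^ 'n" assume x: "\<forall>i. \<bar>x $ i\<bar> < \<epsilon>"
    \<comment> \<open>The coefficient of t^k; it ignores coordinate j of x because j is not in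
      A.\<close>
    define c where "c k = (\<Sum>\<beta>\<in>?S k. a \<beta> * (\<Prod>i\<in>A. (x $ i) ^ \<beta> i))" for k
    have "(\<Sum>k\<le>N. c k * t ^ k) = 0" if t: "\<bar>t\<bar> < \<epsilon>" for t
    proof -
      define y where "y = (\<chi> i. if i = j then t else x $ i)"
      have prod: "(\<Prod>i\<in>insert j A. (y $ i) ^ \<beta> i) = t ^ \<beta> j * (\<Prod>i\<in>A. (x $ i) ^ \<beta> i)" for \<beta>
      proof -
        have "(\<Prod>i\<in>A. (y $ i) ^ \<beta> i) = (\<Prod>i\<in>A. (x $ i) ^ \<beta> i)"
          using insert.hyps by (intro prod.cong) (auto simp: y_def)
        then show ?thesis using insert.hyps by (simp add: y_def)
      qed
      have "(\<Sum>k\<le>N. c k * t ^ k) = (\<Sum>k\<le>N. \<Sum>\<beta>\<in>?S k. a \<beta> * (\<Prod>i\<in>insert j A. (y $ i) ^ \<beta> i))"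
        unfolding prod c_def sum_distrib_right by (intro sum.cong refl) auto
      also have "\<dots> = (\<Sum>\<beta>\<in>S. a \<beta> * (\<Prod>i\<in>insert j A. (y $ i) ^ \<beta> i))"
        using N insert.prems(1) by (intro sum.group) auto
      also have "\<dots> = 0"
        using x t by (intro insert.prems(4)) (auto simp: y_def)
      finally show ?thesis .
    qed
    then have "c (\<alpha> j) = 0"
      using infinite_roots_imp_coeffs_0[OF insert.prems(3), where c = c and N = N and k = "\<alpha> j"]
        N insert.prems(5) by blast
    then show "(\<Sum>\<beta>\<in>?S (\<alpha> j). a \<beta> * (\<Prod>i\<in>A. (x $ i) ^ \<beta> i)) = 0"
      by (simp add: c_def)
  next
    fix \<beta> \<beta>' assume "\<beta> \<in> ?S (\<alpha> j)" "\<beta>' \<in> ?S (\<alpha> j)" "\<forall>i\<in>A. \<beta> i = \<beta>' i"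
    then show "\<beta> = \<beta>'" using insert.prems(2)[of \<beta> \<beta>'] by auto
  qed (use insert.prems in auto)
qed

lemma monomial_sum_eq_0_on_ball:
  fixes a :: "('n :: finite \<Rightarrow> nat) \<Rightarrow> real"
  assumes "\<And>x. x \<in> ball 0 1 \<Longrightarrow> (\<Sum>\<alpha>\<in>multi_indices m. a \<alpha> * monomial \<alpha> x) = 0"
    and "\<alpha> \<in> multi_indices m"
  shows "a \<alpha> = 0"
\<comment> \<open>The half-width is chosen so that the cube has l1 norm below 1 and hence lies in
  the unit ball.\<close>
proof (rule monomials_independent[of UNIV "multi_indices m" "1 / CARD('n)" a \<alpha>])
  fix x :: "real ^ 'n" assume x: "\<forall>i. \<bar>x $ i\<bar> < 1 / CARD('n)"
  have "norm x \<le> (\<Sum>i\<in>UNIV. \<bar>x $ i\<bar>)" by (rule norm_le_l1_cart)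
  also have "\<dots> < (\<Sum>i\<in>(UNIV :: 'n set). 1 / CARD('n))"
    using x by (intro sum_strict_mono) auto
  finally show "(\<Sum>\<alpha>\<in>multi_indices m. a \<alpha> * (\<Prod>i\<in>UNIV. (x $ i) ^ \<alpha> i)) = 0"
    using assms(1)[of x] by (simp add: monomial_def)
qed (use assms in auto)

text \<open>
  Compactness of the unit sphere of the coefficient space, which carries the product topology.
\<close>

lemma polys_coeff_bound:
  "\<exists>C>0. \<forall>a. (\<Sum>\<alpha>\<in>multi_indices m. \<bar>a \<alpha>\<bar>) \<le>
     C * sqrt (LINT x|lebesgue_on (ball (0 :: real ^ 'n) 1).
       (\<Sum>\<alpha>\<in>multi_indices m. a \<alpha> * monomial \<alpha> x)\<^sup>2)"
proof -
  let ?I = "multi_indices m :: ('n \<Rightarrow> nat) set"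
  let ?p = "\<lambda>a x. \<Sum>\<alpha>\<in>?I. a \<alpha> * monomial \<alpha> x"
  let ?L = "lebesgue_on (ball (0 :: real ^ 'n) 1)"
  define Q where "Q a = (LINT x|?L. (?p a x)\<^sup>2)" for a
  define n where "n a = (\<Sum>\<alpha>\<in>?I. \<bar>a \<alpha> :: real\<bar>)" for a
  have cont: "continuous_on UNIV (\<lambda>x :: real ^ 'n. c * (monomial \<alpha> x * monomial \<beta> x))"
    if "\<alpha> \<in> ?I" "\<beta> \<in> ?I" for \<alpha> \<beta> and c :: real
    using that by (intro continuous_intros polys_continuous polys_monomial)
  have int: "integrable ?L (\<lambda>x. c * (monomial \<alpha> x * monomial \<beta> x))"
    if "\<alpha> \<in> ?I" "\<beta> \<in> ?I" for \<alpha> \<beta> and c :: real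
    using that by (intro integrable_lebesgue_on_bounded cont) auto
  \<comment> \<open>Through the Gram matrix of the monomials, Q is a polynomial in finitely many
    coordinates of a, hence continuous for the product topology.\<close>
  have Q: "Q a = (\<Sum>\<alpha>\<in>?I. \<Sum>\<beta>\<in>?I. a \<alpha> * a \<beta> * (LINT x|?L. monomial \<alpha> x * monomial \<beta> x))" for a
  proof -
    have "(?p a x)\<^sup>2 = (\<Sum>\<alpha>\<in>?I. \<Sum>\<beta>\<in>?I. (a \<alpha> * a \<beta>) * (monomial \<alpha> x * monomial \<beta> x))" for x
      unfolding power2_eq_square sum_product by (intro sum.cong refl) (simp add: ac_simps)
    then have "Q a = (LINT x|?L. (\<Sum>\<alpha>\<in>?I. \<Sum>\<beta>\<in>?I. (a \<alpha> * a \<beta>) * (monomial \<alpha> x * monomial \<beta> x)))"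
      by (simp add: Q_def)
    also have "\<dots> = (\<Sum>\<alpha>\<in>?I. \<Sum>\<beta>\<in>?I. LINT x|?L. (a \<alpha> * a \<beta>) * (monomial \<alpha> x * monomial \<beta> x))"
    proof (subst Bochner_Integration.integral_sum)
      show "(\<Sum>\<alpha>\<in>?I. LINT x|?L. (\<Sum>\<beta>\<in>?I. (a \<alpha> * a \<beta>) * (monomial \<alpha> x * monomial \<beta> x))) =
        (\<Sum>\<alpha>\<in>?I. \<Sum>\<beta>\<in>?I. LINT x|?L. (a \<alpha> * a \<beta>) * (monomial \<alpha> x * monomial \<beta> x))"
        by (intro sum.cong refl Bochner_Integration.integral_sum int)
    qed (intro Bochner_Integration.integrable_sum int)
    finally show ?thesis by simp
  qed
  have contQ: "continuous_on UNIV Q"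
    unfolding Q by (intro continuous_intros continuous_on_product_coordinates)
  have contn: "continuous_on UNIV n"
    unfolding n_def by (intro continuous_intros continuous_on_product_coordinates)
  have Q_pos: "Q a > 0" if "n a \<noteq> 0" for a
  proof -
    have pc: "continuous_on UNIV (?p a)"
      by (intro continuous_intros polys_continuous polys_monomial) auto
    have op: "open {x \<in> ball 0 1. ?p a x \<noteq> 0}"
    proof -
      have "open (ball 0 1 \<inter> {x. ?p a x \<noteq> 0})"
        by (intro open_Int open_ball open_Collect_neq pc continuous_intros)
      then show ?thesis by (simp add: Int_def)
    qed
    have "Q a \<noteq> 0"
    proof
      assume "Q a = 0"
      moreover have "integrable ?L (\<lambda>x. (?p a x)\<^sup>2)"
        by (intro integrable_lebesgue_on_bounded continuous_intros pc) auto
      ultimately have "AE x in ?L. (?p a x)\<^sup>2 = 0"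
        unfolding Q_def by (subst (asm) integral_nonneg_eq_0_iff_AE) auto
      then have "AE x in lebesgue. x \<in> ball 0 1 \<longrightarrow> ?p a x = 0"
        by (subst (asm) AE_restrict_space_iff) auto
      then have "{x \<in> ball 0 1. ?p a x \<noteq> 0} \<in> null_sets lebesgue"
        by (subst AE_iff_null_sets) (use op in auto)
      then have "negligible {x \<in> ball 0 1. ?p a x \<noteq> 0}"
        by (simp add: negligible_iff_null_sets)
      then have "{x \<in> ball 0 1. ?p a x \<noteq> 0} = {}"
        using open_not_negligible op by blast
      then have "a \<alpha> = 0" if "\<alpha> \<in> ?I" for \<alpha>
        using monomial_sum_eq_0_on_ball[where m = m and a = a and \<alpha> = \<alpha>] that by blast
      then have "n a = 0" by (simp add: n_def)
      with that show False by simp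
    qed
    moreover have "Q a \<ge> 0" unfolding Q_def by simp
    ultimately show ?thesis by simp
  qed
  \<comment> \<open>Coefficient families are functions on all exponents, so bounding
    \<open>n a\<close> leaves infinitely many coordinates free. Pinning those outside the index set
    to 0 makes B a product of compact sets.\<close>
  define B where "B = (\<Pi>\<^sub>E \<alpha>\<in>(UNIV :: ('n \<Rightarrow> nat) set). if \<alpha> \<in> ?I then {-1..1 :: real} else {0})"
  have "compact B"
    using compactin_PiE[of "\<lambda>_. euclidean" UNIV "\<lambda>\<alpha>. if \<alpha> \<in> ?I then {-1..1 :: real} else {0}"]
    unfolding B_def euclidean_product_topology by auto
  then have "compact (B \<inter> {a. n a = 1})"
    by (intro compact_Int_closed closed_Collect_eq contn continuous_intros)
  have "\<exists>c>0. \<forall>a \<in> B \<inter> {a. n a = 1}. c \<le> Q a"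
  \<comment> \<open>On an empty set there is no minimiser, but any positive c will do.\<close>
  proof (cases "B \<inter> {a. n a = 1} = {}")
    case False
    then obtain a where "a \<in> B \<inter> {a. n a = 1}" "\<forall>a' \<in> B \<inter> {a. n a = 1}. Q a \<le> Q a'"
      using continuous_attains_inf[OF \<open>compact (B \<inter> {a. n a = 1})\<close>, of Q]
        continuous_on_subset[OF contQ] by blast
    then show ?thesis using Q_pos[of a] by (intro exI[of _ "Q a"]) auto
  qed (auto intro: exI[of _ 1])
  then obtain c where c: "c > 0" "\<And>a. a \<in> B \<Longrightarrow> n a = 1 \<Longrightarrow> c \<le> Q a" by auto
  have "n a \<le> 1 / sqrt c * sqrt (Q a)" for a
  proof (cases "n a = 0")
    case False
    \<comment> \<open>Normalise onto the unit sphere; Q is homogeneous of degree 2, so the bound c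
      scales back with \<open>(n a)\<^sup>2\<close>.\<close>
    define a' where "a' \<alpha> = (if \<alpha> \<in> ?I then a \<alpha> / n a else 0)" for \<alpha>
    have n0: "n a > 0" using False unfolding n_def by (simp add: sum_nonneg less_le)
    have "\<bar>a \<alpha>\<bar> \<le> n a" if "\<alpha> \<in> ?I" for \<alpha>
      unfolding n_def using that by (intro member_le_sum) auto
    then have "- n a \<le> a \<alpha> \<and> a \<alpha> \<le> n a" if "\<alpha> \<in> ?I" for \<alpha>
      using that by (meson abs_le_iff minus_le_iff)
    then have "a' \<in> B" using n0 by (auto simp: B_def a'_def divide_le_eq le_divide_eq)
    moreover have "n a' = 1"
    proof -
      have "n a' = (\<Sum>\<alpha>\<in>?I. \<bar>a \<alpha>\<bar> / n a)"
        using n0 unfolding n_def[of a'] by (intro sum.cong) (auto simp: a'_def)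
      also have "\<dots> = 1" using n0 by (simp add: n_def flip: sum_divide_distrib)
      finally show ?thesis .
    qed
    ultimately have "c \<le> Q a'" by (rule c)
    also have "Q a' = Q a / (n a)\<^sup>2"
      unfolding Q sum_divide_distrib
      by (intro sum.cong refl) (simp add: a'_def power2_eq_square)
    finally have "c * (n a)\<^sup>2 \<le> Q a" using n0 by (simp add: field_simps)
    then have "sqrt c * n a \<le> sqrt (Q a)"
      using n0 by (metis abs_of_pos real_sqrt_abs real_sqrt_le_iff real_sqrt_mult)
    then show ?thesis using c(1) by (simp add: field_simps)
  qed (use c(1) in \<open>simp add: Q_def\<close>)
  then show ?thesis
    using c(1) unfolding n_def Q_def by (intro exI[of _ "1 / sqrt c"]) auto
qed

text \<open>The bound has to be uniform in the direction with the factor \<open>norm b\<close>.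
  Induction over sums and coordinate factors yields it together with the bound on values, which the
  product rule needs.\<close>

lemma polys_bounded_with_dderiv:
  fixes p :: "real ^ 'n \<Rightarrow> real"
  assumes "p \<in> polys m"
  shows "\<exists>B\<ge>0. \<forall>x \<in> cball 0 M. \<bar>p x\<bar> \<le> B \<and> (\<forall>b. \<bar>dderiv b p x\<bar> \<le> B * norm b)"
  using assms
proof (induction rule: polys_induct)
  case (const m c)
  then show ?case by (intro exI[of _ "\<bar>c\<bar>"]) (auto simp: dderiv_const)
next
  case (add m p q)
  obtain B where B: "B \<ge> 0" "\<And>x. x \<in> cball 0 M \<Longrightarrow> \<bar>p x\<bar> \<le> B"
    "\<And>x b. x \<in> cball 0 M \<Longrightarrow> \<bar>dderiv b p x\<bar> \<le> B * norm b" using add by blast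
  obtain B' where B': "B' \<ge> 0" "\<And>x. x \<in> cball 0 M \<Longrightarrow> \<bar>q x\<bar> \<le> B'"
    "\<And>x b. x \<in> cball 0 M \<Longrightarrow> \<bar>dderiv b q x\<bar> \<le> B' * norm b" using add by blast
  have d: "dderiv b (\<lambda>x. p x + q x) x = dderiv b p x + dderiv b q x" for b x
    using add by (simp add: dderiv_add polys_differentiable)
  show ?case
  proof (intro exI[of _ "B + B'"] conjI ballI allI)
    fix x :: "real ^ 'n" and b :: "real ^ 'n" assume x: "x \<in> cball 0 M"
    show "\<bar>p x + q x\<bar> \<le> B + B'" using B(2)[OF x] B'(2)[OF x] by linarith
    show "\<bar>dderiv b (\<lambda>x. p x + q x) x\<bar> \<le> (B + B') * norm b"
      unfolding d distrib_right using B(3)[OF x, of b] B'(3)[OF x, of b] by linarith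
  qed (use B B' in auto)
next
  case (coord m p j)
  obtain B where B: "B \<ge> 0" "\<And>x. x \<in> cball 0 M \<Longrightarrow> \<bar>p x\<bar> \<le> B"
    "\<And>x b. x \<in> cball 0 M \<Longrightarrow> \<bar>dderiv b p x\<bar> \<le> B * norm b" using coord by blast
  have d: "dderiv b (\<lambda>x. x $ j * p x) x = x $ j * dderiv b p x + b $ j * p x" for b x
    using coord by (simp add: dderiv_mult dderiv_coord polys_differentiable vec_nth_differentiable)
  have x: "\<bar>x $ j\<bar> \<le> \<bar>M\<bar>" if "x \<in> cball 0 M" for x :: "real ^ 'n"
    using that component_le_norm_cart[of x j] by auto
  show ?case
  proof (intro exI[of _ "\<bar>M\<bar> * B + B"] conjI ballI allI)
    fix x :: "real ^ 'n" and b :: "real ^ 'n" assume xM: "x \<in> cball 0 M"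
    have "\<bar>x $ j * p x\<bar> \<le> \<bar>M\<bar> * B"
      unfolding abs_mult using x[OF xM] B(1) B(2)[OF xM] by (intro mult_mono) auto
    then show "\<bar>x $ j * p x\<bar> \<le> \<bar>M\<bar> * B + B" using B by simp
    have "\<bar>x $ j * dderiv b p x\<bar> \<le> \<bar>M\<bar> * (B * norm b)"
      unfolding abs_mult using x[OF xM] B(1) B(3)[OF xM] by (intro mult_mono) auto
    moreover have "\<bar>b $ j * p x\<bar> \<le> norm b * B"
      unfolding abs_mult using B(1) B(2)[OF xM] component_le_norm_cart[of b j]
      by (intro mult_mono) auto
    ultimately show "\<bar>dderiv b (\<lambda>x. x $ j * p x) x\<bar> \<le> (\<bar>M\<bar> * B + B) * norm b"
      unfolding d by (simp add: algebra_simps)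
  qed (use B in auto)
qed

text \<open>Norm equivalence on a finite-dimensional space: values and derivatives on the ball of
  radius M are linear in the coefficients, and these are controlled by the L2 norm on the unit
  ball.\<close>

lemma polys_reference_bound:
  "\<exists>C>0. \<forall>p \<in> polys m. \<forall>x \<in> cball (0 :: real ^ 'n) M. 
     \<bar>p x\<bar> \<le> C * sqrt (LINT x|lebesgue_on (ball 0 1). (p x)\<^sup>2) \<and>
     (\<forall>b. \<bar>dderiv b p x\<bar> \<le> C * norm b * sqrt (LINT x|lebesgue_on (ball 0 1). (p x)\<^sup>2))"
proof -
  let ?I = "multi_indices m :: ('n \<Rightarrow> nat) set"
  obtain C where C: "C > 0" "\<And>a. (\<Sum>\<alpha>\<in>?I. \<bar>a \<alpha>\<bar>) \<le>
     C * sqrt (LINT x|lebesgue_on (ball (0 :: real ^ 'n) 1). (\<Sum>\<alpha>\<in>?I. a \<alpha> * monomial \<alpha> x)\<^sup>2)"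
    using polys_coeff_bound[where 'n = 'n and m = m] by blast
  have "\<forall>\<alpha>\<in>?I. \<exists>B\<ge>0. \<forall>x \<in> cball 0 M. \<bar>monomial \<alpha> x\<bar> \<le> B \<and> (\<forall>b. \<bar>dderiv b (monomial \<alpha>) x\<bar> \<le> B * norm b)"
    by (intro ballI polys_bounded_with_dderiv[of _ m] polys_monomial)
  then obtain B where B: "\<And>\<alpha>. \<alpha> \<in> ?I \<Longrightarrow> B \<alpha> \<ge> 0"
    "\<And>\<alpha> x. \<alpha> \<in> ?I \<Longrightarrow> x \<in> cball 0 M \<Longrightarrow> \<bar>monomial \<alpha> x\<bar> \<le> B \<alpha>"
    "\<And>\<alpha> x b. \<alpha> \<in> ?I \<Longrightarrow> x \<in> cball 0 M \<Longrightarrow> \<bar>dderiv b (monomial \<alpha>) x\<bar> \<le> B \<alpha> * norm b"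
    by metis
  \<comment> \<open>One bound for all monomials; the summand 1 makes it positive.\<close>
  define D where "D = 1 + sum B ?I"
  have BD: "B \<alpha> \<le> D" if "\<alpha> \<in> ?I" for \<alpha>
    unfolding D_def using that B(1) member_le_sum[of \<alpha> ?I B] by auto
  have D: "D > 0" unfolding D_def using B(1) by (simp add: add_pos_nonneg sum_nonneg)
  show ?thesis
  proof (intro exI[of _ "D * C"] conjI ballI allI)
    fix p :: "real ^ 'n \<Rightarrow> real" and x :: "real ^ 'n"
    assume "p \<in> polys m" and x: "x \<in> cball 0 M"
    then obtain a where p: "p = (\<lambda>x. \<Sum>\<alpha>\<in>?I. a \<alpha> * monomial \<alpha> x)" by (auto elim: polysE)
    let ?N = "sqrt (LINT x|lebesgue_on (ball 0 1). (p x)\<^sup>2)"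
    have a: "(\<Sum>\<alpha>\<in>?I. \<bar>a \<alpha>\<bar>) \<le> C * ?N" using C(2)[of a] by (simp add: p)
    have "\<bar>p x\<bar> \<le> (\<Sum>\<alpha>\<in>?I. \<bar>a \<alpha>\<bar> * D)"
      unfolding p
    proof (intro order_trans[OF sum_abs] sum_mono)
      fix \<alpha> assume \<alpha>: "\<alpha> \<in> ?I"
      have "\<bar>monomial \<alpha> x\<bar> \<le> D" using B(2)[OF \<alpha> x] BD[OF \<alpha>] by linarith
      then show "\<bar>a \<alpha> * monomial \<alpha> x\<bar> \<le> \<bar>a \<alpha>\<bar> * D"
        unfolding abs_mult by (intro mult_left_mono) auto
    qed
    also have "\<dots> \<le> C * ?N * D"
      unfolding sum_distrib_right[symmetric] using a D by (intro mult_right_mono) auto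
    finally show "\<bar>p x\<bar> \<le> D * C * ?N" by (simp add: ac_simps)
    fix b :: "real ^ 'n"
    have BD': "\<bar>dderiv b (monomial \<alpha>) x\<bar> \<le> D * norm b" if "\<alpha> \<in> ?I" for \<alpha>
      using B(3)[OF that x, of b] mult_right_mono[OF BD[OF that], of "norm b"] by simp
    have df: "monomial \<alpha> differentiable (at x)" if "\<alpha> \<in> ?I" for \<alpha>
      using polys_differentiable[OF polys_monomial[OF that]] .
    have "dderiv b p x = (\<Sum>\<alpha>\<in>?I. a \<alpha> * dderiv b (monomial \<alpha>) x)"
      unfolding p using df by (simp add: dderiv_sum dderiv_cmult)
    then have "\<bar>dderiv b p x\<bar> \<le> (\<Sum>\<alpha>\<in>?I. \<bar>a \<alpha>\<bar> * (D * norm b))"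
      using BD' by (simp, intro order_trans[OF sum_abs] sum_mono) (simp add: abs_mult mult_left_mono)
    also have "\<dots> \<le> C * ?N * (D * norm b)"
      unfolding sum_distrib_right[symmetric] using a D by (intro mult_right_mono) auto
    finally show "\<bar>dderiv b p x\<bar> \<le> D * C * norm b * ?N" by (simp add: ac_simps)
  qed (use C D in auto)
qed

section \<open>Scaling from the unit ball to general sets\<close>

lemma lebesgue_integral_ball_affine:
  fixes f :: "real ^ 'n \<Rightarrow> real"
  assumes r: "r > 0" and f: "continuous_on UNIV f"
  shows "(LINT x|lebesgue_on (ball x0 r). f x) =
    r ^ CARD('n) * (LINT y|lebesgue_on (ball 0 1). f (x0 + r *\<^sub>R y))"
proof -
  let ?T = "\<lambda>y. x0 + r *\<^sub>R y"
  have fm [measurable]: "f \<in> borel_measurable borel"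
    using f by (rule borel_measurable_continuous_onI)
  have fTm [measurable]: "(\<lambda>y. f (?T y)) \<in> borel_measurable borel"
    by (intro borel_measurable_continuous_onI continuous_on_compose2[OF f] continuous_intros) auto
  have m1: "(\<lambda>x. indicator (ball x0 r) x * f x) \<in> borel_measurable lborel"
    by (subst measurable_lborel2) (intro borel_measurable_times borel_measurable_indicator borel_open open_ball fm)
  have m2: "(\<lambda>y. indicator (ball 0 1) y * f (?T y)) \<in> borel_measurable lborel"
    by (subst measurable_lborel2) (intro borel_measurable_times borel_measurable_indicator borel_open open_ball fTm)
  have ind: "indicator (ball x0 r) (?T y) = (indicator (ball 0 1) y :: real)" for y
    using r by (auto simp: indicator_def dist_norm)
  \<comment> \<open>\<open>lborel_affine\<close> speaks about \<open>lborel\<close>. The integrands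
    are Borel, so their Lebesgue integrals pass to \<open>lborel\<close> and back through the
    completion.\<close>
  have "(LINT x|lebesgue_on (ball x0 r). f x) = (LINT x|lborel. indicator (ball x0 r) x * f x)"
    using integral_completion[OF m1] by (simp add: integral_restrict_space)
  also have "\<dots> = (LINT x|density (distr lborel borel ?T) (\<lambda>_. \<bar>r\<bar> ^ CARD('n)). indicator (ball x0 r) x * f x)"
    using r by (subst lborel_affine[of r x0]) simp_all
  also have "\<dots> = (LINT x|distr lborel borel ?T. \<bar>r\<bar> ^ CARD('n) * (indicator (ball x0 r) x * f x))"
    using m1 by (subst integral_density) simp_all
  also have "\<dots> = (LINT y|lborel. \<bar>r\<bar> ^ CARD('n) * (indicator (ball x0 r) (?T y) * f (?T y)))"
    using m1 by (subst integral_distr) simp_all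
  also have "\<dots> = r ^ CARD('n) * (LINT y|lborel. indicator (ball 0 1) y * f (?T y))"
    using r by (simp add: ind)
  also have "\<dots> = r ^ CARD('n) * (LINT y|lebesgue_on (ball 0 1). f (?T y))"
    using integral_completion[OF m2] by (simp add: integral_restrict_space)
  finally show ?thesis .
qed

lemma dderiv_affine:
  assumes "p differentiable (at (x0 + r *\<^sub>R y))"
  shows "dderiv b (\<lambda>y. p (x0 + r *\<^sub>R y)) y = r * dderiv b p (x0 + r *\<^sub>R y)"
proof -
  have D: "(p has_derivative (\<lambda>b. dderiv b p (x0 + r *\<^sub>R y))) (at (x0 + r *\<^sub>R y))"
    using assms by (rule dderiv_has_derivative)
  have "((\<lambda>y. x0 + r *\<^sub>R y) has_derivative (\<lambda>h. r *\<^sub>R h)) (at y)"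
    by (auto intro!: derivative_eq_intros)
  from diff_chain_at[OF this D]
  have "dderiv b (\<lambda>y. p (x0 + r *\<^sub>R y)) y = dderiv (r *\<^sub>R b) p (x0 + r *\<^sub>R y)"
    by (intro dderiv_eqI[THEN trans]) (auto simp: o_def)
  also have "\<dots> = r * dderiv b p (x0 + r *\<^sub>R y)"
    using linear_cmul[OF has_derivative_linear[OF D], of r b] by simp
  finally show ?thesis .
qed

text \<open>Scaling by r about x0 puts the inner ball on the unit ball and S inside
  \<open>cball 0 M\<close>, where the reference bound holds. The first estimate compares a maximum
  with an L2 norm: |S| is at most a multiple of r^n, and r^n is the Jacobian. The second has maxima
  on both sides, so that it can be iterated for higher derivatives.\<close>

lemma inverse_estimates:
  assumes "M > 0"
  shows "\<exists>C>0. \<forall>(S :: (real ^ 'n) set) x0 r D p.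
    r > 0 \<longrightarrow> D > 0 \<longrightarrow> D \<le> M * r \<longrightarrow> S \<in> sets lebesgue \<longrightarrow> ball x0 r \<subseteq> S \<longrightarrow>
    S \<subseteq> cball x0 D \<longrightarrow> p \<in> polys m \<longrightarrow>
      (\<forall>x\<in>S. measure lebesgue S * (p x)\<^sup>2 \<le> C * (LINT x|lebesgue_on S. (p x)\<^sup>2)) \<and>
      (\<forall>A. (\<forall>x\<in>S. \<bar>p x\<bar> \<le> A) \<longrightarrow> (\<forall>x\<in>S. \<forall>b. \<bar>dderiv b p x\<bar> \<le> C * norm b / D * A))"
proof -
  obtain C where C: "C > 0" and
    C1: "\<And>p x. p \<in> polys m \<Longrightarrow> x \<in> cball (0 :: real ^ 'n) M \<Longrightarrow> 
     \<bar>p x\<bar> \<le> C * sqrt (LINT x|lebesgue_on (ball 0 1). (p x)\<^sup>2)" and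
    C2: "\<And>p x b. p \<in> polys m \<Longrightarrow> x \<in> cball (0 :: real ^ 'n) M \<Longrightarrow> 
     \<bar>dderiv b p x\<bar> \<le> C * norm b * sqrt (LINT x|lebesgue_on (ball 0 1). (p x)\<^sup>2)"
    using polys_reference_bound[where 'n = 'n and m = m and M = M] by blast
  define V where "V = measure lebesgue (ball (0 :: real ^ 'n) 1)"
  have V: "V > 0" unfolding V_def by (simp add: content_ball_pos)
  \<comment> \<open>The first summand serves the bound on values, the second the bound on
    derivatives.\<close>
  define C' where "C' = C\<^sup>2 * M ^ CARD('n) * V + M * C * sqrt V"
  have C': "C\<^sup>2 * M ^ CARD('n) * V \<le> C'" "M * C * sqrt V \<le> C'" "C' > 0"
    unfolding C'_def using V C \<open>M > 0\<close> by (auto simp: add_pos_pos)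
  show ?thesis
  proof (intro exI[of _ C'] conjI allI impI ballI)
    fix S :: "(real ^ 'n) set" and x0 x :: "real ^ 'n" and r D and p :: "real ^ 'n \<Rightarrow> real"
    assume r: "r > 0" and D: "D > 0" "D \<le> M * r" and S: "S \<in> sets lebesgue" "ball x0 r \<subseteq> S" "S \<subseteq> cball x0 D"
      and p: "p \<in> polys m" and x: "x \<in> S"
    define q where "q = (\<lambda>y. p (x0 + r *\<^sub>R y))"
    define y where "y = (1 / r) *\<^sub>R (x - x0)"
    have q: "q \<in> polys m" unfolding q_def using p by (rule polys_affine)
    have xy: "x = x0 + r *\<^sub>R y" using r by (simp add: y_def)
    have y: "y \<in> cball 0 M"
    proof -
      have "norm (x - x0) \<le> D" using x S(3) by (auto simp: dist_norm norm_minus_commute)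
      then show ?thesis using r D by (simp add: y_def divide_simps mult.commute)
    qed
    have bd: "bounded S" using S(3) bounded_cball bounded_subset by blast
    have pc: "continuous_on UNIV (\<lambda>x. (p x)\<^sup>2)"
      by (intro continuous_intros polys_continuous[OF p])
    have qc: "continuous_on UNIV (\<lambda>x. (q x)\<^sup>2)"
      by (intro continuous_intros polys_continuous[OF q])
    let ?N = "LINT x|lebesgue_on (ball 0 1). (q x)\<^sup>2"
    have N0: "?N \<ge> 0" by simp
    {
      have "r ^ CARD('n) * ?N = (LINT x|lebesgue_on (ball x0 r). (p x)\<^sup>2)"
        using lebesgue_integral_ball_affine[OF r pc, of x0] by (simp add: q_def)
      also have "\<dots> \<le> (LINT x|lebesgue_on S. (p x)\<^sup>2)"
        using integrable_lebesgue_on_bounded[OF bd S(1) pc] S(1,2)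
        by (intro integral_mono_lebesgue_on_AE) auto
      finally have N: "r ^ CARD('n) * ?N \<le> (LINT x|lebesgue_on S. (p x)\<^sup>2)" .
      have "measure lebesgue S \<le> measure lebesgue (cball x0 D)"
        using S by (intro measure_mono_fmeasurable) auto
      also have "\<dots> = D ^ CARD('n) * V"
        using D(1) by (simp add: content_cball content_ball V_def)
      also have "\<dots> \<le> (M * r) ^ CARD('n) * V"
        using D V by (intro mult_right_mono power_mono) auto
      finally have mS: "measure lebesgue S \<le> (M * r) ^ CARD('n) * V" .
      have "(p x)\<^sup>2 \<le> (C * sqrt ?N)\<^sup>2"
        using C1[OF q y] unfolding q_def xy by (rule abs_le_square_iff[THEN iffD1, OF order_trans]) auto
      also have "\<dots> = C\<^sup>2 * ?N" by (simp add: power_mult_distrib)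
      finally have "measure lebesgue S * (p x)\<^sup>2 \<le> ((M * r) ^ CARD('n) * V) * (C\<^sup>2 * ?N)"
        using mS V r \<open>M > 0\<close> by (intro mult_mono) auto
      also have "\<dots> = (C\<^sup>2 * M ^ CARD('n) * V) * (r ^ CARD('n) * ?N)"
        by (simp add: power_mult_distrib)
      also have "\<dots> \<le> C' * (LINT x|lebesgue_on S. (p x)\<^sup>2)"
        using N C' r N0 by (intro mult_mono) auto
      finally show "measure lebesgue S * (p x)\<^sup>2 \<le> C' * (LINT x|lebesgue_on S. (p x)\<^sup>2)" .
    }
    {
      fix A b assume A: "\<forall>x\<in>S. \<bar>p x\<bar> \<le> A"
      have A0: "A \<ge> 0" using A x by force
      have "?N \<le> (LINT x|lebesgue_on (ball (0 :: real ^ 'n) 1). A\<^sup>2)"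
      proof (rule integral_mono)
        fix z assume "z \<in> space (lebesgue_on (ball (0 :: real ^ 'n) 1))"
        then have "x0 + r *\<^sub>R z \<in> ball x0 r" using r by (simp add: dist_norm)
        then have "\<bar>q z\<bar> \<le> A" using A S(2) by (auto simp: q_def)
        then show "(q z)\<^sup>2 \<le> A\<^sup>2" by (simp add: abs_le_square_iff[symmetric] A0)
      qed (auto intro!: integrable_lebesgue_on_bounded qc)
      also have "\<dots> = A\<^sup>2 * V" by (simp add: V_def measure_restrict_space)
      finally have "sqrt ?N \<le> A * sqrt V"
        using A0 by (metis abs_of_nonneg real_sqrt_abs real_sqrt_le_mono real_sqrt_mult)
      have "r * \<bar>dderiv b p x\<bar> = \<bar>dderiv b q y\<bar>"
        unfolding q_def xy using r
        by (subst dderiv_affine[OF polys_differentiable[OF p]]) (simp add: abs_mult)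
      also have "\<dots> \<le> C * norm b * sqrt ?N" by (rule C2[OF q y])
      also have "\<dots> \<le> C * norm b * (A * sqrt V)"
        using C \<open>sqrt ?N \<le> A * sqrt V\<close> by (intro mult_left_mono) auto
      \<comment> \<open>The chain rule gives 1/r; the factor \<open>D \<le> M * r\<close> exchanges
        it for M/D.\<close>
      finally have "D * (r * \<bar>dderiv b p x\<bar>) \<le> M * r * (C * norm b * (A * sqrt V))"
        using D r \<open>M > 0\<close> by (rule_tac mult_mono) auto
      then have "r * (D * \<bar>dderiv b p x\<bar>) \<le> r * ((M * C * sqrt V) * (norm b * A))"
        by (simp add: ac_simps)
      then have "D * \<bar>dderiv b p x\<bar> \<le> (M * C * sqrt V) * (norm b * A)"
        using r by simp
      also have "\<dots> \<le> C' * (norm b * A)" using C' A0 by (intro mult_right_mono) auto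
      finally show "\<bar>dderiv b p x\<bar> \<le> C' * norm b / D * A"
        using D by (simp add: field_simps)
    }
  qed (use C' in auto)
qed

section \<open>Local approximation on a cell\<close>

lemma dderiv_power_Suc_div_fact:
  fixes f :: "real ^ 'n \<Rightarrow> real"
  assumes "f differentiable (at x)"
  shows "dderiv b (\<lambda>x. f x ^ Suc k / fact (Suc k)) x = f x ^ k / fact k * dderiv b f x"
proof -
  have "((\<lambda>x. inverse (fact (Suc k)) * f x ^ Suc k) has_derivative
      (\<lambda>d. inverse (fact (Suc k)) * (of_nat (Suc k) * dderiv d f x * f x ^ k))) (at x)"
    using has_derivative_power[OF dderiv_has_derivative[OF assms], of "Suc k"]
    by (intro has_derivative_mult_right) simp
  from dderiv_eqI[OF this, of b] show ?thesis
    by (simp add: field_simps del: of_nat_Suc)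
qed

lemma dderiv_funpow_polys: "h \<in> polys m \<Longrightarrow> (dderiv b ^^ k) h \<in> polys (m - k)"
  by (induction k) (auto dest: dderiv_polys)

text \<open>
  Repeated integration by parts gives a polynomial antiderivative along \<open>b\<close> in terms of the
  iterated derivatives of \<open>h\<close>, which are controlled by the inverse estimate.
\<close>

lemma antiderivative_polys:
  fixes h :: "real ^ 'n \<Rightarrow> real"
  assumes "h \<in> polys m" "b \<noteq> 0" "D > 0" "C \<ge> 0" "A \<ge> 0"
    and inv: "\<And>p A x. p \<in> polys m \<Longrightarrow> \<forall>x\<in>S. \<bar>p x\<bar> \<le> A \<Longrightarrow> x \<in> S \<Longrightarrow>
      \<bar>dderiv b p x\<bar> \<le> C * norm b / D * A"
    and S: "S \<subseteq> cball x0 D" and A: "\<forall>x\<in>S. \<bar>h x\<bar> \<le> A"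
  shows "\<exists>P \<in> polys (Suc m). (\<forall>x. dderiv b P x = h x) \<and>
    (\<forall>x\<in>S. \<bar>P x\<bar> \<le> D / norm b * (\<Sum>k\<le>m. C ^ k) * A)"
proof -
  \<comment> \<open>A coordinate along b, scaled so that its derivative along b is 1; on S its size
    is at most \<open>D / norm b\<close>.\<close>
  define \<tau> where "\<tau> = (\<lambda>x. (x - x0) \<bullet> ((1 / (norm b)\<^sup>2) *\<^sub>R b))"
  define T where "T = (\<lambda>k x. \<tau> x ^ k / fact k)"
  define H where "H = (\<lambda>k. (dderiv b ^^ k) h)"
  \<comment> \<open>With T k = tau^k / k! each term differentiates into two, and the alternating
    signs cancel all but h and the term with the derivative of order m + 1.\<close>
  define P where "P = (\<lambda>x. \<Sum>k\<le>m. (-1) ^ k * (T (Suc k) x * H k x))"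
  have \<tau>: "\<tau> \<in> polys 1" unfolding \<tau>_def by (rule polys_inner_diff)
  have d\<tau>: "dderiv b \<tau> x = 1" for x
    unfolding \<tau>_def dderiv_inner_diff using assms(2) by (simp add: dot_square_norm)
  have T: "T k \<in> polys k" for k
    using polys_cmult[OF polys_power[OF \<tau>, of k], of "inverse (fact k)"]
    by (simp add: T_def field_simps)
  have H: "H k \<in> polys (m - k)" for k
    unfolding H_def using assms(1) by (rule dderiv_funpow_polys)
  have dT: "dderiv b (T (Suc k)) x = T k x" for k x
    unfolding T_def using dderiv_power_Suc_div_fact[OF polys_differentiable[OF \<tau>]] d\<tau> by simp
  have dH: "dderiv b (H k) = H (Suc k)" for k by (simp add: H_def)
  \<comment> \<open>The degree bound for \<open>H (Suc m)\<close> would still be 0; its vanishing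
    comes from \<open>H m\<close> being constant.\<close>
  have "H (Suc m) = (\<lambda>x. 0)" using dderiv_polys_0[of "H m" b] H[of m] by (simp add: dH)
  have P: "P \<in> polys (Suc m)"
    unfolding P_def
  proof (intro polys_sum polys_cmult)
    fix k assume "k \<in> {..m}"
    then show "(\<lambda>x. T (Suc k) x * H k x) \<in> polys (Suc m)"
      using polys_mult[OF T[of "Suc k"] H[of k]] by simp
  qed
  have dTH: "dderiv b (\<lambda>x. T (Suc k) x * H k x) x = T (Suc k) x * H (Suc k) x + T k x * H k x" for k x
    using polys_differentiable[OF T] polys_differentiable[OF H] by (simp add: dderiv_mult dT dH)
  have diff: "(\<lambda>x. T (Suc k) x * H k x) differentiable at x" for k x
    by (intro differentiable_mult polys_differentiable[OF T] polys_differentiable[OF H])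
  have "dderiv b P x = h x" for x
  proof -
    let ?G = "\<lambda>k. (-1) ^ k * (T k x * H k x)"
    have "dderiv b P x = (\<Sum>k\<le>m. (-1) ^ k * (T (Suc k) x * H (Suc k) x + T k x * H k x))"
      unfolding P_def using diff by (simp add: dderiv_sum dderiv_cmult dTH)
    also have "\<dots> = (\<Sum>k\<le>m. ?G k - ?G (Suc k))"
      by (intro sum.cong refl) (simp add: algebra_simps)
    also have "\<dots> = ?G 0 - ?G (Suc m)" by (rule sum_telescope)
    also have "\<dots> = h x" using \<open>H (Suc m) = (\<lambda>x. 0)\<close> by (simp add: T_def H_def)
    finally show ?thesis .
  qed
  moreover have "\<bar>P x\<bar> \<le> D / norm b * (\<Sum>k\<le>m. C ^ k) * A" if x: "x \<in> S" for x
  proof -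
    have "\<bar>\<tau> x\<bar> \<le> norm (x - x0) * norm ((1 / (norm b)\<^sup>2) *\<^sub>R b)"
      unfolding \<tau>_def by (rule Cauchy_Schwarz_ineq2)
    also have "\<dots> \<le> D * (1 / norm b)"
      using S x assms(2,3)
      by (intro mult_mono) (auto simp: dist_norm norm_minus_commute power2_eq_square)
    finally have \<tau>D: "\<bar>\<tau> x\<bar> \<le> D / norm b" by simp
    have Hk: "\<forall>x\<in>S. \<bar>H k x\<bar> \<le> (C * norm b / D) ^ k * A" for k
    proof (induction k)
      case (Suc k)
      \<comment> \<open>The inverse estimate is available for degree m, so the lower degree of
        \<open>H k\<close> is relaxed to reuse the same C at every order.\<close>
      have "H k \<in> polys m" using H[of k] by (rule polys_le) simp
      then show ?case using inv[OF _ Suc] by (auto simp: dH[symmetric] mult.assoc)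
    qed (use A in \<open>simp add: H_def\<close>)
    have "\<bar>(-1) ^ k * (T (Suc k) x * H k x)\<bar> \<le> D / norm b * C ^ k * A" for k
    proof -
      have "\<bar>T (Suc k) x\<bar> \<le> \<bar>\<tau> x\<bar> ^ Suc k"
        using frac_le[of "\<bar>\<tau> x\<bar> ^ Suc k" "\<bar>\<tau> x\<bar> ^ Suc k" 1 "fact (Suc k)"] fact_ge_1[of "Suc k"]
        unfolding T_def abs_divide power_abs by (simp del: fact_Suc power_Suc)
      also have "\<dots> \<le> (D / norm b) ^ Suc k" using \<tau>D by (intro power_mono) auto
      finally have "\<bar>T (Suc k) x * H k x\<bar> \<le> (D / norm b) ^ Suc k * ((C * norm b / D) ^ k * A)"
        unfolding abs_mult using Hk x assms(3) by (intro mult_mono) auto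
      \<comment> \<open>Of the k + 1 factors \<open>D / norm b\<close> gained by integration, k
        cancel against those lost by differentiation.\<close>
      also have "\<dots> = D / norm b * ((D / norm b) * (C * norm b / D)) ^ k * A"
        by (simp only: power_mult_distrib power_Suc ac_simps)
      also have "(D / norm b) * (C * norm b / D) = C" using assms(2,3) by simp
      finally show ?thesis by (simp add: abs_mult power_abs)
    qed
    then have "\<bar>P x\<bar> \<le> (\<Sum>k\<le>m. D / norm b * C ^ k * A)"
      unfolding P_def by (intro order_trans[OF sum_abs] sum_mono)
    then show ?thesis by (simp add: sum_distrib_left sum_distrib_right)
  qed
  ultimately show ?thesis using P by blast
qed

text \<open>The pairs of q and its derivative along b form a subspace of a product of two L2 spaces,
  and \<open>orth\<close> makes the error of R orthogonal to it. Both conclusions are Pythagoras,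
  written pointwise so that the mixed term appears as a difference whose integral is zero.\<close>

lemma projection_identities:
  fixes R g h v :: "real ^ 'n \<Rightarrow> real" and K :: "(real ^ 'n) set"
  assumes K: "bounded K" "K \<in> sets lebesgue"
    and R: "R \<in> polys m" and g: "g \<in> polys k" and h: "h \<in> polys l"
    and orth: "\<And>q. q \<in> polys m \<Longrightarrow>
      (LINT x|lebesgue_on K. R x * q x + dderiv b R x * dderiv b q x) =
      (LINT x|lebesgue_on K. g x * q x + h x * dderiv b q x)"
  defines "E \<equiv> \<lambda>v. (LINT x|lebesgue_on K. (v x - g x)\<^sup>2 + (dderiv b v x - h x)\<^sup>2)"
  shows "v \<in> polys m \<Longrightarrow> E R \<le> E v"
    and "(LINT x|lebesgue_on K. (R x)\<^sup>2 + (dderiv b R x)\<^sup>2) =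
      (LINT x|lebesgue_on K. (g x)\<^sup>2 + (h x)\<^sup>2) - E R"
proof -
  note cont = polys_continuous[OF R] polys_continuous[OF g] polys_continuous[OF h]
    polys_continuous[OF dderiv_polys[OF R]]
  note int = integrable_lebesgue_on_bounded[OF K]
  have iE: "integrable (lebesgue_on K) (\<lambda>x. (R x - g x)\<^sup>2 + (dderiv b R x - h x)\<^sup>2)"
    by (intro int continuous_intros cont)
  {
    assume v: "v \<in> polys m"
    define q where "q = (\<lambda>x. v x - R x)"
    have q: "q \<in> polys m" unfolding q_def using v R by (rule polys_diff)
    have dq: "dderiv b q x = dderiv b v x - dderiv b R x" for x
      unfolding q_def using v R by (simp add: dderiv_diff polys_differentiable)
    note contq = polys_continuous[OF q] polys_continuous[OF dderiv_polys[OF q]]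
    have i1: "integrable (lebesgue_on K) (\<lambda>x. (q x)\<^sup>2 + (dderiv b q x)\<^sup>2)"
      and i2: "integrable (lebesgue_on K) (\<lambda>x. R x * q x + dderiv b R x * dderiv b q x)"
      and i3: "integrable (lebesgue_on K) (\<lambda>x. g x * q x + h x * dderiv b q x)"
      by (intro int continuous_intros cont contq)+
    \<comment> \<open>Twice the last bracket is the mixed term of the square of (R - g) + q and its
      companion for h.\<close>
    have "E v = (LINT x|lebesgue_on K.
        (((R x - g x)\<^sup>2 + (dderiv b R x - h x)\<^sup>2) + ((q x)\<^sup>2 + (dderiv b q x)\<^sup>2)) +
        2 * ((R x * q x + dderiv b R x * dderiv b q x) - (g x * q x + h x * dderiv b q x)))"
      unfolding E_def dq unfolding q_def
      by (intro Bochner_Integration.integral_cong) (auto simp: power2_eq_square algebra_simps)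
    also have "\<dots> = E R + (LINT x|lebesgue_on K. (q x)\<^sup>2 + (dderiv b q x)\<^sup>2)"
      using iE i1 i2 i3 orth[OF q] unfolding E_def
      by (simp del: distrib_left_numeral right_diff_distrib_numeral)
    also have "\<dots> \<ge> E R" by (simp add: integral_nonneg_AE)
    finally show "E R \<le> E v" .
  }
  have i2: "integrable (lebesgue_on K) (\<lambda>x. R x * R x + dderiv b R x * dderiv b R x)"
    and i3: "integrable (lebesgue_on K) (\<lambda>x. g x * R x + h x * dderiv b R x)"
    and i4: "integrable (lebesgue_on K) (\<lambda>x. (g x)\<^sup>2 + (h x)\<^sup>2)"
    by (intro int continuous_intros cont)+
  \<comment> \<open>Here the test function is R itself.\<close>
  have "(LINT x|lebesgue_on K. (R x)\<^sup>2 + (dderiv b R x)\<^sup>2) = (LINT x|lebesgue_on K.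
      (((g x)\<^sup>2 + (h x)\<^sup>2) - ((R x - g x)\<^sup>2 + (dderiv b R x - h x)\<^sup>2)) +
      2 * ((R x * R x + dderiv b R x * dderiv b R x) - (g x * R x + h x * dderiv b R x)))"
    by (intro Bochner_Integration.integral_cong) (auto simp: power2_eq_square algebra_simps)
  also have "\<dots> = (LINT x|lebesgue_on K. (g x)\<^sup>2 + (h x)\<^sup>2) - E R"
    using iE i2 i3 i4 orth[OF R] unfolding E_def
      by (simp del: distrib_left_numeral right_diff_distrib_numeral)
  finally show "(LINT x|lebesgue_on K. (R x)\<^sup>2 + (dderiv b R x)\<^sup>2) =
      (LINT x|lebesgue_on K. (g x)\<^sup>2 + (h x)\<^sup>2) - E R" .
qed

text \<open>The mean value inequality needs the operator norm of the full derivative, which is why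
  the inverse estimate covers all directions and not only the transport direction.\<close>

lemma polys_lipschitz:
  fixes g :: "real ^ 'n \<Rightarrow> real"
  assumes "g \<in> polys m" "convex S" "\<And>x b. x \<in> S \<Longrightarrow> \<bar>dderiv b g x\<bar> \<le> L * norm b"
    and "x \<in> S" "y \<in> S" "L \<ge> 0"
  shows "\<bar>g x - g y\<bar> \<le> L * norm (x - y)"
proof -
  have D: "(g has_derivative (\<lambda>b. dderiv b g z)) (at z within S)" for z
    by (rule has_derivative_at_withinI[OF dderiv_has_derivative[OF polys_differentiable[OF assms(1)]]])
  have L: "onorm (\<lambda>b. dderiv b g z) \<le> L" if "z \<in> S" for z
  proof (rule onorm_bound)
    fix d
    show "norm (dderiv d g z) \<le> L * norm d"
      using assms(3)[OF that] by simp
  qed (rule assms(6))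
  have "norm (g x - g y) \<le> L * norm (x - y)"
    by (rule differentiable_bound[OF assms(2) D L assms(4,5)])
  then show ?thesis by simp
qed

text \<open>The first estimate, freed from grids: F is any family of subsets of S whose measures sum
  to at most |S|. The number sigma bounds both D and diam K / D, one for the antiderivative and the
  other for the oscillation of g.\<close>

lemma projection_error_sum:
  assumes "M > 0" "\<beta> > 0"
  shows "\<exists>C>0. \<forall>(S :: (real ^ 'n) set) x0 r D b \<sigma> g h F R.
    r > 0 \<longrightarrow> D > 0 \<longrightarrow> D \<le> M * r \<longrightarrow> ball x0 r \<subseteq> S \<longrightarrow> S \<subseteq> cball x0 D \<longrightarrow>
    convex S \<longrightarrow> S \<in> sets lebesgue \<longrightarrow> b \<noteq> 0 \<longrightarrow> inverse (norm b) \<le> \<beta> \<longrightarrow> D \<le> \<sigma> \<longrightarrow>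
    g \<in> polys (Suc m) \<longrightarrow> h \<in> polys m \<longrightarrow>
    (\<forall>K\<in>F. K \<subseteq> S \<and> K \<noteq> {} \<and> K \<in> sets lebesgue \<and> diameter K \<le> \<sigma> * D \<and> R K \<in> polys (Suc m) \<and>
      (\<forall>q \<in> polys (Suc m).
        (LINT x|lebesgue_on K. R K x * q x + dderiv b (R K) x * dderiv b q x) =
        (LINT x|lebesgue_on K. g x * q x + h x * dderiv b q x))) \<longrightarrow>
    (\<Sum>K\<in>F. measure lebesgue K) \<le> measure lebesgue S \<longrightarrow>
    (\<Sum>K\<in>F. LINT x|lebesgue_on K. (R K x - g x)\<^sup>2 + (dderiv b (R K) x - h x)\<^sup>2)
      \<le> C * \<sigma>\<^sup>2 * ((LINT x|lebesgue_on S. (g x)\<^sup>2) + (LINT x|lebesgue_on S. (h x)\<^sup>2))"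
proof -
  from inverse_estimates[OF assms(1), where m = "Suc m" and 'n = 'n]
  obtain C where CI: "C > 0 \<and> (\<forall>(S :: (real ^ 'n) set) x0 r D p.
    r > 0 \<longrightarrow> D > 0 \<longrightarrow> D \<le> M * r \<longrightarrow> S \<in> sets lebesgue \<longrightarrow> ball x0 r \<subseteq> S \<longrightarrow>
    S \<subseteq> cball x0 D \<longrightarrow> p \<in> polys (Suc m) \<longrightarrow>
      (\<forall>x\<in>S. measure lebesgue S * (p x)\<^sup>2 \<le> C * (LINT x|lebesgue_on S. (p x)\<^sup>2)) \<and>
      (\<forall>A. (\<forall>x\<in>S. \<bar>p x\<bar> \<le> A) \<longrightarrow> (\<forall>x\<in>S. \<forall>b. \<bar>dderiv b p x\<bar> \<le> C * norm b / D * A)))"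
    ..
  note C = conjunct1[OF CI] and I = conjunct2[OF CI]
  define s where "s = (\<Sum>k\<le>m. C ^ k)"
  have s: "s \<ge> 0" unfolding s_def using C by (intro sum_nonneg) simp
  \<comment> \<open>The 2 comes from the square of a sum, the outer C from trading maxima for L2
    norms, \<open>\<beta> * s\<close> from the antiderivative and the inner C from the Lipschitz
    bound of g.\<close>
  define C' where "C' = 2 * C * ((\<beta> * s)\<^sup>2 + C\<^sup>2)"
  have "C' > 0" unfolding C'_def using C by (simp add: add_nonneg_pos)
  show ?thesis
  proof (intro exI[of _ C'] conjI allI impI)
    fix S :: "(real ^ 'n) set" and x0 r D b \<sigma> g h F R
    assume r: "r > 0" and D: "D > 0" "D \<le> M * r" and S: "ball x0 r \<subseteq> S" "S \<subseteq> cball x0 D"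
      "convex S" "S \<in> sets lebesgue" and b: "b \<noteq> 0" "inverse (norm b) \<le> \<beta>" and \<sigma>: "D \<le> \<sigma>"
      and g: "g \<in> polys (Suc m)" and h: "h \<in> polys m"
      and F: "\<forall>K\<in>F. K \<subseteq> S \<and> K \<noteq> {} \<and> K \<in> sets lebesgue \<and> diameter K \<le> \<sigma> * D \<and> R K \<in> polys (Suc m) \<and>
      (\<forall>q \<in> polys (Suc m).
        (LINT x|lebesgue_on K. R K x * q x + dderiv b (R K) x * dderiv b q x) =
        (LINT x|lebesgue_on K. g x * q x + h x * dderiv b q x))"
      and meas: "(\<Sum>K\<in>F. measure lebesgue K) \<le> measure lebesgue S"
    have I': "(\<forall>x\<in>S. measure lebesgue S * (p x)\<^sup>2 \<le> C * (LINT x|lebesgue_on S. (p x)\<^sup>2)) \<and>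
      (\<forall>A. (\<forall>x\<in>S. \<bar>p x\<bar> \<le> A) \<longrightarrow> (\<forall>x\<in>S. \<forall>b. \<bar>dderiv b p x\<bar> \<le> C * norm b / D * A))"
      if "p \<in> polys (Suc m)" for p
      using I that r D S(1,2,4) by simp
    have I1: "measure lebesgue S * (p x)\<^sup>2 \<le> C * (LINT x|lebesgue_on S. (p x)\<^sup>2)"
      if "p \<in> polys (Suc m)" "x \<in> S" for p x
      using I'[OF that(1)] that(2) by blast
    have I2: "\<bar>dderiv d p x\<bar> \<le> C * norm d / D * A"
      if "p \<in> polys (Suc m)" "\<forall>x\<in>S. \<bar>p x\<bar> \<le> A" "x \<in> S" for p A x d
      using I'[OF that(1)] that(2,3) by blast
    have bS: "bounded S" using S(2) bounded_cball bounded_subset by blast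
    have mS: "measure lebesgue S > 0"
    proof -
      have "0 < measure lebesgue (ball x0 r)" using r by (simp add: content_ball_pos)
      also have "\<dots> \<le> measure lebesgue S"
        using S bS by (intro measure_mono_fmeasurable) (auto intro: bounded_set_imp_lmeasurable)
      finally show ?thesis .
    qed
    \<comment> \<open>The maximum bound granted by the inverse estimate, normalised so that |S|
      times its square is exactly C times the squared L2 norm.\<close>
    define A where "A p = sqrt (C * (LINT x|lebesgue_on S. (p x)\<^sup>2) / measure lebesgue S)" for p
    have A0: "A p \<ge> 0" for p unfolding A_def using C mS by simp
    have A2: "measure lebesgue S * (A p)\<^sup>2 = C * (LINT x|lebesgue_on S. (p x)\<^sup>2)" for p
      unfolding A_def using C mS by simp
    have A: "\<forall>x\<in>S. \<bar>p x\<bar> \<le> A p" if "p \<in> polys (Suc m)" for p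
    proof
      fix x assume x: "x \<in> S"
      have "measure lebesgue S * (p x)\<^sup>2 \<le> measure lebesgue S * (A p)\<^sup>2"
        unfolding A2 using I1[OF that x] .
      then have "(p x)\<^sup>2 \<le> (A p)\<^sup>2" using mS by simp
      then show "\<bar>p x\<bar> \<le> A p" using A0 by (metis abs_le_square_iff abs_of_nonneg)
    qed
    obtain P where P: "P \<in> polys (Suc m)" "\<And>x. dderiv b P x = h x"
      and Pb: "\<And>x. x \<in> S \<Longrightarrow> \<bar>P x\<bar> \<le> D / norm b * s * A h"
    proof -
      have "\<exists>P \<in> polys (Suc m). (\<forall>x. dderiv b P x = h x) \<and>
         (\<forall>x\<in>S. \<bar>P x\<bar> \<le> D / norm b * (\<Sum>k\<le>m. C ^ k) * A h)"
      proof (rule antiderivative_polys[OF h b(1) D(1) _ A0 _ S(2) A[OF polys_Suc[OF h]]])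
        fix p A x assume "p \<in> polys m" "\<forall>x\<in>S. \<bar>p x\<bar> \<le> A" "x \<in> S"
        then show "\<bar>dderiv b p x\<bar> \<le> C * norm b / D * A" by (intro I2 polys_Suc)
      qed (use C in simp)
      then show ?thesis using that unfolding s_def by blast
    qed
    have \<sigma>0: "\<sigma> > 0" using D \<sigma> by simp
    \<comment> \<open>A bound on the squared pointwise error of the competitor, the same for every
      K.\<close>
    define W where "W = (\<sigma> * (\<beta> * s * A h) + \<sigma> * (C * A g))\<^sup>2"
    have loc: "(LINT x|lebesgue_on K. (R K x - g x)\<^sup>2 + (dderiv b (R K) x - h x)\<^sup>2) \<le> measure lebesgue K * W"
      if "K \<in> F" for K
    proof -
      have K: "K \<subseteq> S" "K \<noteq> {}" "K \<in> sets lebesgue" "diameter K \<le> \<sigma> * D" "R K \<in> polys (Suc m)"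
        "\<And>q. q \<in> polys (Suc m) \<Longrightarrow>
        (LINT x|lebesgue_on K. R K x * q x + dderiv b (R K) x * dderiv b q x) =
        (LINT x|lebesgue_on K. g x * q x + h x * dderiv b q x)"
        using F that by auto
      have bK: "bounded K" using K(1) bS bounded_subset by blast
      obtain y where y: "y \<in> K" using K(2) by blast
      \<comment> \<open>The derivative part of the error vanishes; the rest is P x plus the
        oscillation g y - g x.\<close>
      define v where "v = (\<lambda>x. P x + g y)"
      have v: "v \<in> polys (Suc m)" unfolding v_def by (intro polys_add P polys_const)
      have dv: "dderiv b v x = h x" for x
        unfolding v_def using P by (simp add: dderiv_add polys_differentiable dderiv_const)
      have "(LINT x|lebesgue_on K. (R K x - g x)\<^sup>2 + (dderiv b (R K) x - h x)\<^sup>2)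
        \<le> (LINT x|lebesgue_on K. (v x - g x)\<^sup>2 + (dderiv b v x - h x)\<^sup>2)"
        by (rule projection_identities(1)[OF bK K(3) K(5) g h K(6) v])
      also have "\<dots> \<le> (LINT x|lebesgue_on K. W)"
      proof (rule integral_mono)
        show "integrable (lebesgue_on K) (\<lambda>x. (v x - g x)\<^sup>2 + (dderiv b v x - h x)\<^sup>2)"
          unfolding dv
          by (intro integrable_lebesgue_on_bounded bK K continuous_intros
              polys_continuous[OF v] polys_continuous[OF g] polys_continuous[OF h])
        show "integrable (lebesgue_on K) (\<lambda>x. W)"
          by (intro integrable_lebesgue_on_bounded bK K continuous_intros)
        fix x assume "x \<in> space (lebesgue_on K)"
        then have x: "x \<in> K" by simp
        have "\<bar>P x\<bar> \<le> D * inverse (norm b) * (s * A h)"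
          using Pb[of x] x K(1) by (auto simp: divide_inverse mult.assoc)
        \<comment> \<open>Here \<open>D \<le> \<sigma>\<close> turns the length scale of S into a
          factor sigma.\<close>
        also have "\<dots> \<le> \<sigma> * \<beta> * (s * A h)"
          using \<sigma> b D \<sigma>0 s A0[of h] assms(2) by (intro mult_mono mult_nonneg_nonneg) auto
        finally have 1: "\<bar>P x\<bar> \<le> \<sigma> * (\<beta> * s * A h)" by (simp add: ac_simps)
        \<comment> \<open>The Lipschitz bound is taken on the convex set S, where the inverse
          estimate lives. Its 1/D then cancels against
          \<open>diameter K \<le> \<sigma> * D\<close>.\<close>
        have "\<bar>g y - g x\<bar> \<le> (C / D * A g) * norm (y - x)"
        proof (rule polys_lipschitz[OF g S(3)])
          fix z d assume z: "z \<in> S"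
          show "\<bar>dderiv d g z\<bar> \<le> C / D * A g * norm d"
            using I2[OF g A[OF g] z, of d] by (simp add: ac_simps)
        qed (use x y K(1) C D(1) A0 in auto)
        also have "\<dots> \<le> (C / D * A g) * (\<sigma> * D)"
        proof (intro mult_left_mono)
          have "norm (y - x) \<le> diameter K"
            using diameter_bounded_bound[OF bK y x] by (simp add: dist_norm)
          then show "norm (y - x) \<le> \<sigma> * D" using K(4) by simp
        qed (use C D A0 in auto)
        also have "\<dots> = \<sigma> * (C * A g)" using D by simp
        finally have 2: "\<bar>g y - g x\<bar> \<le> \<sigma> * (C * A g)" .
        have "\<bar>v x - g x\<bar> \<le> \<sigma> * (\<beta> * s * A h) + \<sigma> * (C * A g)"
          unfolding v_def using 1 2 by linarith
        then have "(v x - g x)\<^sup>2 \<le> W"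
          unfolding W_def by (intro abs_le_square_iff[THEN iffD1]) linarith
        then show "(v x - g x)\<^sup>2 + (dderiv b v x - h x)\<^sup>2 \<le> W"
          unfolding dv by simp
      qed
      also have "\<dots> = measure lebesgue K * W" using K(3) by (simp add: measure_restrict_space)
      finally show ?thesis .
    qed
    have "W \<le> 2 * (\<sigma> * (\<beta> * s * A h))\<^sup>2 + 2 * (\<sigma> * (C * A g))\<^sup>2"
      
      unfolding W_def power2_sum
      using sum_squares_bound[of "\<sigma> * (\<beta> * s * A h)" "\<sigma> * (C * A g)"] by linarith
    also have "\<dots> = 2 * \<sigma>\<^sup>2 * ((\<beta> * s)\<^sup>2 * (A h)\<^sup>2 + C\<^sup>2 * (A g)\<^sup>2)"
      by (simp add: power_mult_distrib algebra_simps)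
    finally have W: "W \<le> 2 * \<sigma>\<^sup>2 * ((\<beta> * s)\<^sup>2 * (A h)\<^sup>2 + C\<^sup>2 * (A g)\<^sup>2)" .
    let ?G = "LINT x|lebesgue_on S. (g x)\<^sup>2" and ?H = "LINT x|lebesgue_on S. (h x)\<^sup>2"
    have "(\<Sum>K\<in>F. LINT x|lebesgue_on K. (R K x - g x)\<^sup>2 + (dderiv b (R K) x - h x)\<^sup>2)
      \<le> (\<Sum>K\<in>F. measure lebesgue K) * W"
      unfolding sum_distrib_right by (intro sum_mono loc)
    also have "\<dots> \<le> measure lebesgue S * (2 * \<sigma>\<^sup>2 * ((\<beta> * s)\<^sup>2 * (A h)\<^sup>2 + C\<^sup>2 * (A g)\<^sup>2))"
      using meas W mS by (intro mult_mono) (auto simp: W_def)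
    also have "\<dots> = 2 * \<sigma>\<^sup>2 * ((\<beta> * s)\<^sup>2 * (measure lebesgue S * (A h)\<^sup>2) + C\<^sup>2 * (measure lebesgue S * (A g)\<^sup>2))"
      by (simp add: algebra_simps)
    also have "\<dots> = 2 * \<sigma>\<^sup>2 * C * ((\<beta> * s)\<^sup>2 * ?H + C\<^sup>2 * ?G)"
      unfolding A2 by (simp add: algebra_simps)
    also have "\<dots> \<le> 2 * \<sigma>\<^sup>2 * C * (((\<beta> * s)\<^sup>2 + C\<^sup>2) * (?G + ?H))"
    proof (intro mult_left_mono)
      have "0 \<le> (\<beta> * s)\<^sup>2 * ?G" "0 \<le> C\<^sup>2 * ?H" by simp_all
      then show "(\<beta> * s)\<^sup>2 * ?H + C\<^sup>2 * ?G \<le> ((\<beta> * s)\<^sup>2 + C\<^sup>2) * (?G + ?H)"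
        unfolding distrib_left distrib_right by linarith
    qed (use C in simp)
    also have "\<dots> = C' * \<sigma>\<^sup>2 * (?G + ?H)" by (simp add: C'_def)
    finally show "(\<Sum>K\<in>F. LINT x|lebesgue_on K. (R K x - g x)\<^sup>2 + (dderiv b (R K) x - h x)\<^sup>2)
      \<le> C' * \<sigma>\<^sup>2 * (?G + ?H)" .
  qed (use \<open>C' > 0\<close> in auto)
qed

section \<open>Cells and partitions\<close>

lemma full_simplex_interior_nonempty:
  fixes K :: "(real ^ 'n) set"
  assumes "int CARD('n) simplex K"
  shows "interior K \<noteq> {}"
proof -
  have "aff_dim K = int DIM(real ^ 'n)" using aff_dim_simplex[OF assms] by simp
  then have "interior K = rel_interior K" by (simp add: interior_rel_interior_gen)
  moreover have "K \<noteq> {}" using assms by auto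
  ultimately show ?thesis
    using rel_interior_eq_empty[OF convex_simplex[OF assms]] by simp
qed

lemma simplex_lebesgue:
  fixes K :: "(real ^ 'n) set"
  assumes "n simplex K"
  shows "K \<in> sets lebesgue" "bounded K" "convex K" "closed K" "negligible (frontier K)"
  using compact_simplex[OF assms] convex_simplex[OF assms]
  by (auto simp: compact_imp_bounded compact_imp_closed lmeasurable_compact fmeasurableD
      negligible_convex_frontier)

lemma negligible_Int_disjoint_interiors:
  assumes "negligible (frontier K)" "negligible (frontier L)" "interior K \<inter> interior L = {}"
  shows "negligible (K \<inter> L)"
proof (rule negligible_subset)
  show "negligible (frontier K \<union> frontier L)" using assms by simp
  show "K \<inter> L \<subseteq> frontier K \<union> frontier L"
    using assms(3) closure_subset by (fastforce simp: frontier_def)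
qed

text \<open>Replaces broken functions and their pointwise derivatives by polynomials. They are
  arbitrary on the frontier, a null set, so integrability is inherited from g through
  \<open>absolutely_integrable_spike\<close>.\<close>

lemma lebesgue_integral_interior_cong:
  fixes f g :: "real ^ 'n \<Rightarrow> real"
  assumes K: "K \<in> sets lebesgue" "negligible (frontier K)"
    and g: "integrable (lebesgue_on K) g"
    and eq: "\<And>x. x \<in> interior K \<Longrightarrow> f x = g x"
  shows "(LINT x|lebesgue_on K. f x) = (LINT x|lebesgue_on K. g x)"
proof -
  have g': "g absolutely_integrable_on K"
    using g K(1) by (simp add: set_integrable_def integrable_restrict_space)
  have eq': "f x = g x" if "x \<in> K - frontier K" for x
    using that eq closure_subset by (auto simp: frontier_def)
  have f': "f absolutely_integrable_on K"
    using absolutely_integrable_spike[OF g' K(2) eq'] .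
  have "(LINT x|lebesgue_on K. f x) = integral K f" "(LINT x|lebesgue_on K. g x) = integral K g"
    using set_lebesgue_integral_eq_integral(2)[OF f'] set_lebesgue_integral_eq_integral(2)[OF g'] K(1)
    by (simp_all add: set_lebesgue_integral_def integral_restrict_space)
  then show ?thesis using integral_spike[OF K(2) eq'] by simp
qed

lemma L2norm_sq: "(L2norm S f)\<^sup>2 = (LINT x|lebesgue_on S. (f x)\<^sup>2)"
  by (simp add: L2norm_def)

lemma simplicial_partitionD:
  assumes "simplicial_partition T S"
  shows "finite T" "\<And>K. K \<in> T \<Longrightarrow> int CARD('n) simplex (K :: (real ^ 'n) set)"
    "\<And>K L. K \<in> T \<Longrightarrow> L \<in> T \<Longrightarrow> K \<noteq> L \<Longrightarrow> interior K \<inter> interior L = {}" "\<Union>T = S"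
  using assms unfolding simplicial_partition_def by auto

text \<open>The starting partition T is arbitrary since two instances occur: from the initial
  partition to a member of the family, and from such a member to its subgrid. The second conclusion
  says that \<open>K'\<close> is tiled by the subcells it contains; the third carries constancy of c
  down to finer cells.\<close>

lemma refinements_partition:
  assumes "T' \<in> refinements split T" "refinement_rule split" "simplicial_partition T S"
  shows "simplicial_partition T' S" "\<And>K'. K' \<in> T \<Longrightarrow> \<Union>(cells_in T' K') = K'"
    "\<And>L. L \<in> T' \<Longrightarrow> \<exists>K\<in>T. L \<subseteq> K"
proof -
  have "simplicial_partition T' S \<and> (\<forall>K'\<in>T. \<Union>(cells_in T' K') = K') \<and> (\<forall>L\<in>T'. \<exists>K\<in>T. L \<subseteq> K)"
    using assms(1)
  proof induction
    case init
    then show ?case using assms(3) by (auto simp: cells_in_def)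
  next
    case (step T' K)
    then have T': "simplicial_partition T' S" and cov: "\<And>K'. K' \<in> T \<Longrightarrow> \<Union>(cells_in T' K') = K'"
      and sub: "\<And>L. L \<in> T' \<Longrightarrow> \<exists>K\<in>T. L \<subseteq> K" and K: "K \<in> T'" by auto
    have sp: "simplicial_partition (split K) K"
      using assms(2) simplicial_partitionD(2)[OF T' K] by (simp add: refinement_rule_def)
    have int: "interior L \<subseteq> interior K" "L \<subseteq> K" if "L \<in> split K" for L
    proof -
      show "L \<subseteq> K" using that simplicial_partitionD(4)[OF sp] by blast
      then show "interior L \<subseteq> interior K" by (rule interior_mono)
    qed
    have disj: "interior L \<inter> interior L' = {}"
      if "L \<in> split K" "L' \<in> T' - {K}" for L L'
      using simplicial_partitionD(3)[OF T' K, of L'] that int(1)[of L] by auto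
    have "simplicial_partition (T' - {K} \<union> split K) S"
      unfolding simplicial_partition_def
    proof (intro conjI ballI impI)
      show "\<Union>(T' - {K} \<union> split K) = S"
        using simplicial_partitionD(4)[OF sp] simplicial_partitionD(4)[OF T'] K by auto
      fix L L' assume "L \<in> T' - {K} \<union> split K" "L' \<in> T' - {K} \<union> split K" "L \<noteq> L'"
      then show "interior L \<inter> interior L' = {}"
        using disj[of L L'] disj[of L' L] simplicial_partitionD(3)[OF T', of L L']
          simplicial_partitionD(3)[OF sp, of L L'] by blast
    qed (use simplicial_partitionD(1,2)[OF T'] simplicial_partitionD(1,2)[OF sp] in auto)
    moreover have "\<Union>(cells_in (T' - {K} \<union> split K) K') = K'" if K': "K' \<in> T" for K'
    proof
      show "K' \<subseteq> \<Union>(cells_in (T' - {K} \<union> split K) K')"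
      proof
        fix x assume "x \<in> K'"
        then obtain L where L: "L \<in> T'" "L \<subseteq> K'" "x \<in> L"
          using cov[OF K'] by (auto simp: cells_in_def)
        show "x \<in> \<Union>(cells_in (T' - {K} \<union> split K) K')"
        proof (cases "L = K")
          case True
          then obtain L' where "L' \<in> split K" "x \<in> L'" using simplicial_partitionD(4)[OF sp] L by auto
          then show ?thesis using int(2) L True by (auto simp: cells_in_def)
        qed (use L in \<open>auto simp: cells_in_def\<close>)
      qed
    qed (auto simp: cells_in_def)
    moreover have "\<exists>K\<in>T. L \<subseteq> K" if "L \<in> T' - {K} \<union> split K" for L
      using that sub K int(2) by (metis Diff_iff Un_iff order_trans)
    ultimately show ?case by blast
  qed
  then show "simplicial_partition T' S" "\<And>K'. K' \<in> T \<Longrightarrow> \<Union>(cells_in T' K') = K'"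
    "\<And>L. L \<in> T' \<Longrightarrow> \<exists>K\<in>T. L \<subseteq> K" by auto
qed

text \<open>Closed cells overlap, but only in their frontiers, which are null sets by
  convexity.\<close>

lemma lebesgue_integral_partition:
  fixes F :: "real ^ 'n \<Rightarrow> real"
  assumes "finite S" and simp: "\<And>K. K \<in> S \<Longrightarrow> int CARD('n) simplex K"
    and disj: "\<And>K L. K \<in> S \<Longrightarrow> L \<in> S \<Longrightarrow> K \<noteq> L \<Longrightarrow> interior K \<inter> interior L = {}"
    and un: "\<Union>S = K'" and K': "int CARD('n) simplex K'" and F: "continuous_on UNIV F"
  shows "(\<Sum>K\<in>S. LINT x|lebesgue_on K. F x) = (LINT x|lebesgue_on K'. F x)"
proof -
  have *: "(F has_integral (LINT x|lebesgue_on K. F x)) K" if "int CARD('n) simplex K" for K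
    using integrable_lebesgue_on_bounded[OF simplex_lebesgue(2,1)[OF that] F]
      simplex_lebesgue(1)[OF that]
    by (rule has_integral_integral_lebesgue_on)
  have "(F has_integral (\<Sum>K\<in>S. LINT x|lebesgue_on K. F x)) (\<Union>S)"
  proof (rule has_integral_Union[OF assms(1)])
    show "pairwise (\<lambda>K L. negligible (K \<inter> L)) S"
      unfolding pairwise_def
      using negligible_Int_disjoint_interiors simplex_lebesgue(5)[OF simp] disj by blast
  qed (use * simp in auto)
  then show ?thesis using *[OF K'] un has_integral_unique by blast
qed

text \<open>The supremum of the diameters need not be known to be attained, so a ball with more than
  half of it is taken. This gives one factor 2 and the passage from diameter to radius the other;
  \<open>max \<rho> 1\<close> keeps the constant positive.\<close>

lemma shape_ratio_inscribed_ball: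
  fixes K :: "(real ^ 'n) set"
  assumes K: "int CARD('n) simplex K" and \<rho>: "shape_ratio K \<le> \<rho>"
  obtains x r where "r > 0" "ball x r \<subseteq> K" "K \<subseteq> cball x (diameter K)"
    "diameter K > 0" "diameter K \<le> 4 * max \<rho> 1 * r"
proof -
  let ?B = "{diameter (ball x r) |x r. ball x r \<subseteq> K}"
  have bK: "bounded K" by (rule simplex_lebesgue(2)[OF K])
  have bdd: "bdd_above ?B"
    using diameter_subset[OF _ bK] by (intro bdd_aboveI[of _ "diameter K"]) (auto simp del: diameter_ball)
  \<comment> \<open>Some ball of positive radius shows that the supremum is positive, so the
    quotient in \<open>shape_ratio\<close> is genuine.\<close>
  obtain x1 r1 where "r1 > 0" "ball x1 r1 \<subseteq> K"
    using full_simplex_interior_nonempty[OF K] by (auto simp: mem_interior)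
  then have "2 * r1 \<in> ?B" by (auto intro!: exI[of _ x1] exI[of _ r1])
  then have "2 * r1 \<le> Sup ?B" using bdd by (rule cSup_upper)
  then have S: "Sup ?B > 0" using \<open>r1 > 0\<close> by simp
  then have "Sup ?B / 2 < Sup ?B" by simp
  moreover have "?B \<noteq> {}" using \<open>2 * r1 \<in> ?B\<close> by blast
  ultimately obtain d where d: "d \<in> ?B" "Sup ?B / 2 < d" by (rule less_cSupE)
  then obtain x r where xr: "d = diameter (ball x r)" "ball x r \<subseteq> K" by blast
  have r: "r > 0" "d = 2 * r" using d S xr(1) by (auto split: if_splits)
  have x: "x \<in> K" using xr(2) r(1) by auto
  have D: "diameter K > 0"
    using diameter_subset[OF xr(2) bK] xr(1) r by simp
  have "diameter K \<le> \<rho> * Sup ?B"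
    using \<rho> S unfolding shape_ratio_def by (simp add: divide_le_eq)
  also have "\<dots> \<le> max \<rho> 1 * (4 * r)" using d(2) r S by (intro mult_mono) auto
  finally have "diameter K \<le> 4 * max \<rho> 1 * r" by simp
  moreover have "K \<subseteq> cball x (diameter K)"
    using diameter_bounded_bound[OF bK x] by auto
  ultimately show thesis using that r(1) xr(2) D by blast
qed

section \<open>The grids of the family and the residual on a single cell\<close>

context transport_dpg
begin

lemma TT_partition: "T \<in> TT \<Longrightarrow> simplicial_partition T (closure \<Omega>)"
  using refinements_partition(1)[OF _ rule initial_partition] family by blast

lemma TT_simplex: "T \<in> TT \<Longrightarrow> K \<in> T \<Longrightarrow> int CARD('n) simplex K"
  using simplicial_partitionD(2)[OF TT_partition] .

lemma subgrid_partition: "T \<in> TT \<Longrightarrow> simplicial_partition (s T) (closure \<Omega>)"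
  using subgrid TT_partition by blast

lemma Union_cells_in_subgrid: "T \<in> TT \<Longrightarrow> K' \<in> T \<Longrightarrow> \<Union>(cells_in (s T) K') = K'"
  using refinements_partition(2)[OF _ rule TT_partition] subgrid by blast

text \<open>Cells tile only the closure of the domain, while the load is integrated over the domain
  itself. As the domain is the interior of a closed set, its closure adds no interior
  points.\<close>

lemma interior_cell_subset_domain:
  assumes "T \<in> TT" "K \<in> T"
  shows "interior K \<subseteq> \<Omega>"
proof -
  obtain F where F: "finite F" "\<forall>P\<in>F. polytope P" "\<Omega> = interior (\<Union>F)"
    using domain by (auto simp: polytopal_domain_def)
  then have "closed (\<Union>F)" by (intro closed_Union) (auto intro: polytope_imp_closed)
  then have "closure \<Omega> \<subseteq> \<Union>F" unfolding F(3) by (intro closure_minimal interior_subset)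
  moreover have "K \<subseteq> closure \<Omega>" using simplicial_partitionD(4)[OF TT_partition] assms by blast
  ultimately show ?thesis unfolding F(3) by (intro interior_mono) blast
qed

lemma open_domain: "open \<Omega>"
  using domain by (auto simp: polytopal_domain_def)

lemma coefficient_constant:
  assumes "T \<in> TT" "K \<in> T"
  shows "\<exists>a. \<forall>x\<in>interior K. c x = a"
proof -
  obtain K0 where "K0 \<in> T0" "K \<subseteq> K0"
    using refinements_partition(3)[OF _ rule initial_partition] family assms by blast
  moreover from this obtain a where "\<forall>x\<in>interior K0. c x = a" using c_piecewise_constant by blast
  ultimately show ?thesis using interior_mono[of K K0] by (intro exI[of _ a]) blast
qed

text \<open>A real supremum dominates its members only once they are known to be bounded, and
  likewise the maxima need finite nonempty sets; most of the proof supplies this.\<close>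

lemma subgrid_sigma_ge:
  assumes T: "T \<in> TT" and K': "K' \<in> T"
  shows "diameter K' \<le> subgrid_sigma TT s"
    and "K \<in> cells_in (s T) K' \<Longrightarrow> diameter K / diameter K' \<le> subgrid_sigma TT s"
proof -
  define m where "m T K' = max (MAX K\<in>cells_in (s T) K'. diameter K / diameter K') (diameter K')" for T K'
  \<comment> \<open>Ratios are at most 1 because subcells lie in \<open>K'\<close>; diameters are at
    most that of the closed domain.\<close>
  define B where "B = max 1 (diameter (closure \<Omega>))"
  have fin: "finite (cells_in (s T) K')" if "T \<in> TT" for T K'
    using simplicial_partitionD(1)[OF subgrid_partition[OF that]] by (simp add: cells_in_def)
  have ne: "cells_in (s T) K' \<noteq> {}" if "T \<in> TT" "K' \<in> T" for T K'
    using Union_cells_in_subgrid[OF that] full_simplex_interior_nonempty[OF TT_simplex[OF that]] by auto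
  have bd: "bounded (closure \<Omega>)"
    using simplicial_partitionD(4)[OF initial_partition] simplicial_partitionD(1)[OF initial_partition]
      simplex_lebesgue(2)[OF simplicial_partitionD(2)[OF initial_partition]]
    by (metis bounded_Union)
  have "m T K' \<le> B" if "T \<in> TT" "K' \<in> T" for T K'
  proof -
    have "K' \<subseteq> closure \<Omega>" using simplicial_partitionD(4)[OF TT_partition] that by blast
    then have "diameter K' \<le> diameter (closure \<Omega>)" using bd by (rule diameter_subset)
    moreover have "diameter K / diameter K' \<le> 1" if "K \<in> cells_in (s T) K'" for K
    proof -
      have "diameter K \<le> diameter K'"
        using that simplex_lebesgue(2)[OF TT_simplex[OF \<open>T \<in> TT\<close> \<open>K' \<in> T\<close>]]
        by (intro diameter_subset) (auto simp: cells_in_def)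
      then show ?thesis
        using diameter_ge_0[OF simplex_lebesgue(2)[OF TT_simplex[OF \<open>T \<in> TT\<close> \<open>K' \<in> T\<close>]]]
        by (auto simp: divide_le_eq_1)
    qed
    ultimately have "(MAX K\<in>cells_in (s T) K'. diameter K / diameter K') \<le> 1"
      and "diameter K' \<le> diameter (closure \<Omega>)"
      using fin[OF that(1)] ne[OF that] by simp_all
    then show ?thesis by (auto simp: m_def B_def)
  qed
  then have MB: "Max (m T ` T) \<le> B" if "T \<in> TT" "T \<noteq> {}" for T
    using that simplicial_partitionD(1)[OF TT_partition] by simp
  have TTne: "T \<noteq> {}" if "T \<in> TT" for T
  proof -
    have "closure \<Omega> \<noteq> {}" using domain unfolding polytopal_domain_def closure_eq_empty by blast
    then have "\<Union>T \<noteq> {}" unfolding simplicial_partitionD(4)[OF TT_partition[OF that]] .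
    then show ?thesis by blast
  qed
  have "bdd_above ((\<lambda>T. Max (m T ` T)) ` TT)"
    using MB TTne by (intro bdd_aboveI2[of _ _ B]) blast
  then have "Max (m T ` T) \<le> (SUP T\<in>TT. Max (m T ` T))"
    using T by (intro cSUP_upper)
  moreover have "m T K' \<le> Max (m T ` T)"
    using simplicial_partitionD(1)[OF TT_partition[OF T]] K' by simp
  ultimately have m: "m T K' \<le> subgrid_sigma TT s"
    by (simp add: subgrid_sigma_def m_def)
  then show "diameter K' \<le> subgrid_sigma TT s" by (simp add: m_def)
  assume "K \<in> cells_in (s T) K'"
  then have "diameter K / diameter K' \<le> (MAX K\<in>cells_in (s T) K'. diameter K / diameter K')"
    using fin[OF T, of K'] by (intro Max_ge) auto
  then show "diameter K / diameter K' \<le> subgrid_sigma TT s" using m by (simp add: m_def)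
qed

lemma shape_ratio_le: "T \<in> TT \<Longrightarrow> K \<in> T \<Longrightarrow> shape_ratio K \<le> shape_const TT"
  unfolding shape_const_def using shape_regular by (intro cSUP_upper) auto

text \<open>
  Testing the lifted residual with polynomials supported in a single cell \<open>K\<close> shows that its
  restriction to \<open>K\<close> is the projection of the pair \<open>(g, h) = (\<partial>\<^sub>b w + c u - f, w - u)\<close>.
\<close>

lemma cellwise_projection:
  assumes T: "T \<in> TT" and K': "K' \<in> T" and uw: "(u, w) \<in> trial_space mu mw b \<Omega> T"
    and f: "f \<in> broken_polys mf T" and R: "lifted_residual (Suc m) b c \<Omega> (s T) u w f R"
    and deg: "mu \<le> m" "mw \<le> m" "mf \<le> Suc m"
  shows "\<exists>g h p. g \<in> polys (Suc m) \<and> h \<in> polys m \<and>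
    (estimator b c K' u w f)\<^sup>2 = (LINT x|lebesgue_on K'. (g x)\<^sup>2) + (LINT x|lebesgue_on K'. (h x)\<^sup>2) \<and>
    (\<forall>K\<in>cells_in (s T) K'. p K \<in> polys (Suc m) \<and>
      (\<forall>q \<in> polys (Suc m).
        (LINT x|lebesgue_on K. p K x * q x + dderiv b (p K) x * dderiv b q x) =
        (LINT x|lebesgue_on K. g x * q x + h x * dderiv b q x)) \<and>
      (L2norm K (\<lambda>x. R x - (dderiv b w x + c x * u x - f x)))\<^sup>2
        + (L2norm K (\<lambda>x. dderiv b R x - (w x - u x)))\<^sup>2 =
        (LINT x|lebesgue_on K. (p K x - g x)\<^sup>2 + (dderiv b (p K) x - h x)\<^sup>2) \<and>
      (L2norm K R)\<^sup>2 + (L2norm K (dderiv b R))\<^sup>2 =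
        (LINT x|lebesgue_on K. (p K x)\<^sup>2 + (dderiv b (p K) x)\<^sup>2))"
proof -
  have bp: "\<exists>p\<in>polys l. \<forall>x\<in>interior K'. v x = p x" if "v \<in> broken_polys k T" "k \<le> l" for v k l
    using that K' polys_le unfolding broken_polys_def by blast
  have "u \<in> broken_polys mu T" "w \<in> broken_polys mw T"
    using uw by (auto simp: trial_space_def)
  from bp[OF this(1) deg(1)] bp[OF this(2) deg(2)] bp[OF f deg(3)]
  obtain pu pw pf where pu: "pu \<in> polys m" "\<And>x. x \<in> interior K' \<Longrightarrow> u x = pu x"
    and pw: "pw \<in> polys m" "\<And>x. x \<in> interior K' \<Longrightarrow> w x = pw x"
    and pf: "pf \<in> polys (Suc m)" "\<And>x. x \<in> interior K' \<Longrightarrow> f x = pf x"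
    by blast
  obtain a where a: "\<And>x. x \<in> interior K' \<Longrightarrow> c x = a"
    using coefficient_constant[OF T K'] by blast
  have "\<forall>K\<in>s T. \<exists>q\<in>polys (Suc m). \<forall>x\<in>interior K. R x = q x"
    using R by (simp add: lifted_residual_def broken_polys_def)
  then obtain p where p: "\<And>K. K \<in> s T \<Longrightarrow> p K \<in> polys (Suc m)"
    "\<And>K x. K \<in> s T \<Longrightarrow> x \<in> interior K \<Longrightarrow> R x = p K x" by metis
  \<comment> \<open>With c frozen to its value a on \<open>K'\<close> this is a polynomial on all of
    space; only pf may reach degree m + 1, while h stays within degree m.\<close>
  define g where "g = (\<lambda>x. dderiv b pw x + a * pu x - pf x)"
  define h where "h = (\<lambda>x. pw x - pu x)"
  have dpw: "dderiv b pw \<in> polys (Suc m)"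
    using dderiv_polys[OF pw(1)] by (rule polys_le) simp
  have g: "g \<in> polys (Suc m)"
    unfolding g_def by (intro polys_add polys_diff polys_cmult dpw polys_Suc[OF pu(1)] pf(1))
  have h: "h \<in> polys m" unfolding h_def by (intro polys_diff pw(1) pu(1))
  have dw: "dderiv b w x = dderiv b pw x" if "x \<in> interior K'" for x
    using that pw(2) by (intro dderiv_cong_open[of "interior K'"]) auto
  note cont = polys_continuous[OF g] polys_continuous[OF h] polys_continuous[OF pf(1)]
    polys_continuous[OF pu(1)] polys_continuous[OF pw(1)] polys_continuous[OF dpw]
  \<comment> \<open>The one gate from broken data to polynomials: agreement in the interior of a
    cell is enough.\<close>
  have cell: "(LINT x|lebesgue_on K. F x) = (LINT x|lebesgue_on K. G x)"
    if "int CARD('n) simplex K" "continuous_on UNIV G" "\<And>x. x \<in> interior K \<Longrightarrow> F x = G x"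
    for K and F G :: "real ^ 'n \<Rightarrow> real"
    using lebesgue_integral_interior_cong[OF simplex_lebesgue(1,5)[OF that(1)]
        integrable_lebesgue_on_bounded[OF simplex_lebesgue(2,1)[OF that(1)] that(2)], of F] that(3)
    by blast
  have est: "(estimator b c K' u w f)\<^sup>2 =
      (LINT x|lebesgue_on K'. (g x)\<^sup>2) + (LINT x|lebesgue_on K'. (h x)\<^sup>2)"
  proof -
    have "(LINT x|lebesgue_on K'. (u x - w x)\<^sup>2) = (LINT x|lebesgue_on K'. (h x)\<^sup>2)"
      by (intro cell TT_simplex[OF T K'] continuous_intros cont)
        (simp add: h_def pu pw power2_commute)
    moreover have "(LINT x|lebesgue_on K'. (dderiv b w x + c x * u x - f x)\<^sup>2) = (LINT x|lebesgue_on K'. (g x)\<^sup>2)"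
      by (intro cell TT_simplex[OF T K'] continuous_intros cont)
        (simp add: g_def pu pf dw a)
    ultimately show ?thesis
      by (simp add: estimator_def L2norm_sq)
  qed
  have loc: "p K \<in> polys (Suc m) \<and>
      (\<forall>q \<in> polys (Suc m).
        (LINT x|lebesgue_on K. p K x * q x + dderiv b (p K) x * dderiv b q x) =
        (LINT x|lebesgue_on K. g x * q x + h x * dderiv b q x)) \<and>
      (L2norm K (\<lambda>x. R x - (dderiv b w x + c x * u x - f x)))\<^sup>2
        + (L2norm K (\<lambda>x. dderiv b R x - (w x - u x)))\<^sup>2 =
        (LINT x|lebesgue_on K. (p K x - g x)\<^sup>2 + (dderiv b (p K) x - h x)\<^sup>2) \<and>
      (L2norm K R)\<^sup>2 + (L2norm K (dderiv b R))\<^sup>2 =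
        (LINT x|lebesgue_on K. (p K x)\<^sup>2 + (dderiv b (p K) x)\<^sup>2)"
    if "K \<in> cells_in (s T) K'" for K
  proof -
    have K: "K \<in> s T" "K \<subseteq> K'" using that by (auto simp: cells_in_def)
    have sT: "s T \<in> TT" using subgrid T by blast
    have simp: "int CARD('n) simplex L" if "L \<in> s T" for L using TT_simplex[OF sT that] .
    have sK: "int CARD('n) simplex K" using simp[OF K(1)] .
    have iK: "x \<in> interior K'" if "x \<in> interior K" for x using that interior_mono[OF K(2)] by blast
    note int = integrable_lebesgue_on_bounded[OF simplex_lebesgue(2,1)[OF sK]]
    have pK: "p K \<in> polys (Suc m)" using p(1)[OF K(1)] .
    note contp = polys_continuous[OF pK] polys_continuous[OF dderiv_polys[OF pK]]
    have dR: "dderiv b R x = dderiv b (p K) x" if "x \<in> interior K" for x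
      using that p(2)[OF K(1)] by (intro dderiv_cong_open[of "interior K"]) auto
    have orth: "(LINT x|lebesgue_on K. p K x * q x + dderiv b (p K) x * dderiv b q x) =
        (LINT x|lebesgue_on K. g x * q x + h x * dderiv b q x)" if q: "q \<in> polys (Suc m)" for q
    proof -
      \<comment> \<open>Extension by zero is admissible because broken polynomials need no
        continuity; in the interior of every other cell both v and its derivative vanish.\<close>
      define v where "v = (\<lambda>x. if x \<in> interior K then q x else 0)"
      have v0: "v x = 0" if "x \<in> interior L" "L \<in> s T" "L \<noteq> K" for x L
        using that simplicial_partitionD(3)[OF subgrid_partition[OF T] K(1), of L] by (auto simp: v_def)
      have dv0: "dderiv b v x = 0" if "x \<in> interior L" "L \<in> s T" "L \<noteq> K" for x L
      proof -
        have "dderiv b v x = dderiv b (\<lambda>x. 0) x"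
          using that v0 by (intro dderiv_cong_open[of "interior L"]) auto
        then show ?thesis by (simp add: dderiv_const)
      qed
      have dv: "dderiv b v x = dderiv b q x" if "x \<in> interior K" for x
        using that by (intro dderiv_cong_open[of "interior K"]) (auto simp: v_def)
      have vq: "v x = q x" if "x \<in> interior K" for x using that by (simp add: v_def)
      note contq = polys_continuous[OF q] polys_continuous[OF dderiv_polys[OF q]]
      have "v \<in> broken_polys (Suc m) (s T)"
        unfolding broken_polys_def
      proof safe
        fix L assume L: "L \<in> s T"
        show "\<exists>p\<in>polys (Suc m). \<forall>x\<in>interior L. v x = p x"
          using v0[OF _ L] q by (cases "L = K")
            (auto simp: v_def intro: bexI[of _ q] bexI[of _ "\<lambda>x. 0", OF _ polys_const])
      qed
      then have eq: "broken_inner b (s T) R v =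
        (\<Sum>K\<in>s T. LINT x|lebesgue_on K.
           (c x * u x + dderiv b w x) * v x + (w x - u x) * dderiv b v x)
        - (LINT x|lebesgue_on \<Omega>. f x * v x)"
        using R by (simp add: lifted_residual_def)
      have single: "(\<Sum>L\<in>s T. \<phi> L) = \<phi> K" if "\<And>L. L \<in> s T \<Longrightarrow> L \<noteq> K \<Longrightarrow> \<phi> L = 0"
        for \<phi> :: "(real ^ 'n) set \<Rightarrow> real"
        using that sum.remove[OF simplicial_partitionD(1)[OF subgrid_partition[OF T]] K(1), of \<phi>]
        by simp
      have zero: "(LINT x|lebesgue_on L. F x) = 0"
        if "L \<in> s T" "\<And>x. x \<in> interior L \<Longrightarrow> F x = 0"
        for L and F :: "real ^ 'n \<Rightarrow> real"
        using cell[OF simp[OF that(1)], of "\<lambda>x. 0" F] that(2) by (simp add: continuous_on_const)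
      have "broken_inner b (s T) R v =
          (LINT x|lebesgue_on K. R x * v x) + (LINT x|lebesgue_on K. dderiv b R x * dderiv b v x)"
        unfolding broken_inner_def
        by (rule single) (simp add: zero v0 dv0)
      also have "(LINT x|lebesgue_on K. R x * v x) = (LINT x|lebesgue_on K. p K x * q x)"
        by (intro cell sK continuous_intros contp contq) (simp add: vq p(2)[OF K(1)])
      also have "(LINT x|lebesgue_on K. dderiv b R x * dderiv b v x) =
          (LINT x|lebesgue_on K. dderiv b (p K) x * dderiv b q x)"
        by (intro cell sK continuous_intros contp contq) (simp add: dR dv)
      also have "(LINT x|lebesgue_on K. p K x * q x) + (LINT x|lebesgue_on K. dderiv b (p K) x * dderiv b q x) =
          (LINT x|lebesgue_on K. p K x * q x + dderiv b (p K) x * dderiv b q x)"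
        by (intro Bochner_Integration.integral_add[symmetric] int continuous_intros contp contq)
      finally have lhs: "broken_inner b (s T) R v = \<dots>" .
      have "(\<Sum>K\<in>s T. LINT x|lebesgue_on K.
           (c x * u x + dderiv b w x) * v x + (w x - u x) * dderiv b v x) =
         (LINT x|lebesgue_on K. (c x * u x + dderiv b w x) * v x + (w x - u x) * dderiv b v x)"
        by (rule single) (simp add: zero v0 dv0)
      also have "\<dots> = (LINT x|lebesgue_on K. (a * pu x + dderiv b pw x) * q x + h x * dderiv b q x)"
        by (intro cell sK continuous_intros cont contq)
          (simp add: vq dv a[OF iK] pu(2)[OF iK] pw(2)[OF iK] dw[OF iK] h_def)
      finally have rhs1: "(\<Sum>K\<in>s T. LINT x|lebesgue_on K.
           (c x * u x + dderiv b w x) * v x + (w x - u x) * dderiv b v x) = \<dots>" .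
      \<comment> \<open>v lives on the interior of K, which lies in both K and the domain, so the
        two integrands agree at every point.\<close>
      have "indicator \<Omega> x *\<^sub>R (f x * v x) = indicator K x *\<^sub>R (f x * v x)" for x
        using interior_cell_subset_domain[OF sT K(1)] interior_subset[of K]
        by (auto simp: v_def indicator_def)
      then have "(LINT x|lebesgue_on \<Omega>. f x * v x) = (LINT x|lebesgue_on K. f x * v x)"
        using simplex_lebesgue(1)[OF sK] open_domain
        by (subst (1 2) integral_restrict_space) (simp_all only:, auto)
      also have "\<dots> = (LINT x|lebesgue_on K. pf x * q x)"
        by (intro cell sK continuous_intros cont contq) (simp add: vq pf(2)[OF iK])
      finally have rhs2: "(LINT x|lebesgue_on \<Omega>. f x * v x) = \<dots>" .
      have "(LINT x|lebesgue_on K. p K x * q x + dderiv b (p K) x * dderiv b q x) =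
        (LINT x|lebesgue_on K. (a * pu x + dderiv b pw x) * q x + h x * dderiv b q x)
        - (LINT x|lebesgue_on K. pf x * q x)"
        using eq unfolding lhs rhs1 rhs2 .
      also have "\<dots> = (LINT x|lebesgue_on K.
          ((a * pu x + dderiv b pw x) * q x + h x * dderiv b q x) - pf x * q x)"
        by (intro Bochner_Integration.integral_diff[symmetric] int continuous_intros cont contq)
      also have "\<dots> = (LINT x|lebesgue_on K. g x * q x + h x * dderiv b q x)"
        by (intro Bochner_Integration.integral_cong) (auto simp: g_def algebra_simps)
      finally show ?thesis .
    qed
    have "(LINT x|lebesgue_on K. (R x - (dderiv b w x + c x * u x - f x))\<^sup>2) =
        (LINT x|lebesgue_on K. (p K x - g x)\<^sup>2)"
      by (intro cell sK continuous_intros cont contp)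
        (simp add: p(2)[OF K(1)] a[OF iK] pu(2)[OF iK] pf(2)[OF iK] dw[OF iK] g_def)
    moreover have "(LINT x|lebesgue_on K. (dderiv b R x - (w x - u x))\<^sup>2) =
        (LINT x|lebesgue_on K. (dderiv b (p K) x - h x)\<^sup>2)"
      by (intro cell sK continuous_intros cont contp)
        (simp add: dR pu(2)[OF iK] pw(2)[OF iK] h_def)
    moreover have "(LINT x|lebesgue_on K. (R x)\<^sup>2) = (LINT x|lebesgue_on K. (p K x)\<^sup>2)"
      by (intro cell sK continuous_intros contp) (simp add: p(2)[OF K(1)])
    moreover have "(LINT x|lebesgue_on K. (dderiv b R x)\<^sup>2) = (LINT x|lebesgue_on K. (dderiv b (p K) x)\<^sup>2)"
      by (intro cell sK continuous_intros contp) (simp add: dR)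
    moreover have "(LINT x|lebesgue_on K. (p K x - g x)\<^sup>2) + (LINT x|lebesgue_on K. (dderiv b (p K) x - h x)\<^sup>2) =
        (LINT x|lebesgue_on K. (p K x - g x)\<^sup>2 + (dderiv b (p K) x - h x)\<^sup>2)"
      by (intro Bochner_Integration.integral_add[symmetric] int continuous_intros cont contp)
    moreover have "(LINT x|lebesgue_on K. (p K x)\<^sup>2) + (LINT x|lebesgue_on K. (dderiv b (p K) x)\<^sup>2) =
        (LINT x|lebesgue_on K. (p K x)\<^sup>2 + (dderiv b (p K) x)\<^sup>2)"
      by (intro Bochner_Integration.integral_add[symmetric] int continuous_intros contp)
    ultimately show ?thesis
      unfolding L2norm_sq using pK orth by simp
  qed
  show ?thesis using g h est loc by blast
qed

end

section \<open>Assembly of the two estimates\<close>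

theorem proposition5p6:
  fixes mu mw mf mv :: nat and \<beta> \<gamma> \<rho> :: real
  assumes "mw \<ge> 1" and "mv \<ge> max (max (mw + 1) (mu + 1)) mf"
  shows "\<exists>C>0. \<forall>(\<Omega> :: (real ^ 'n) set) b c T0 split TT s T u w f K' R.
    transport_dpg \<Omega> b c T0 split TT s \<longrightarrow>
    T \<in> TT \<longrightarrow> (u, w) \<in> trial_space mu mw b \<Omega> T \<longrightarrow> f \<in> broken_polys mf T \<longrightarrow> K' \<in> T \<longrightarrow>
    lifted_residual mv b c \<Omega> (s T) u w f R \<longrightarrow>
    inverse (norm b) \<le> \<beta> \<longrightarrow>
    esssup (lebesgue_on K') (\<lambda>x. ereal \<bar>c x\<bar>) \<le> ereal \<gamma> \<longrightarrow>
    shape_const TT \<le> \<rho> \<longrightarrow>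
    (\<Sum>K\<in>cells_in (s T) K'.
        (L2norm K (\<lambda>x. R x - (dderiv b w x + c x * u x - f x)))\<^sup>2
        + (L2norm K (\<lambda>x. dderiv b R x - (w x - u x)))\<^sup>2)
      \<le> C * (subgrid_sigma TT s)\<^sup>2 * (estimator b c K' u w f)\<^sup>2
    \<and> \<bar>(broken_norm b (cells_in (s T) K') R)\<^sup>2 - (estimator b c K' u w f)\<^sup>2\<bar>
      \<le> C * subgrid_sigma TT s * (estimator b c K' u w f)\<^sup>2"
proof -
  \<comment> \<open>The assumed bound makes mv at least 1; m = mv - 1 is the degree available for
    h.\<close>
  obtain m where mv: "mv = Suc m" using assms(2) by (cases mv) auto
  have deg: "mu \<le> m" "mw \<le> m" "mf \<le> Suc m" using assms(2) mv by auto
  \<comment> \<open>The ratio of diameter to radius granted by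
    \<open>shape_ratio_inscribed_ball\<close>.\<close>
  define M where "M = 4 * max \<rho> 1"
  have M: "M > 0" by (simp add: M_def)
  \<comment> \<open>\<open>\<beta>\<close> is an arbitrary real here, and the constant must be fixed
    before any b is given.\<close>
  have "max \<beta> 1 > 0" by simp
  from projection_error_sum[OF M this, where m = m and 'n = 'n]
  obtain C where C: "C > 0 \<and> (\<forall>(S :: (real ^ 'n) set) x0 r D b \<sigma> g h F R.
    r > 0 \<longrightarrow> D > 0 \<longrightarrow> D \<le> M * r \<longrightarrow> ball x0 r \<subseteq> S \<longrightarrow> S \<subseteq> cball x0 D \<longrightarrow>
    convex S \<longrightarrow> S \<in> sets lebesgue \<longrightarrow> b \<noteq> 0 \<longrightarrow> inverse (norm b) \<le> max \<beta> 1 \<longrightarrow> D \<le> \<sigma> \<longrightarrow>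
    g \<in> polys (Suc m) \<longrightarrow> h \<in> polys m \<longrightarrow>
    (\<forall>K\<in>F. K \<subseteq> S \<and> K \<noteq> {} \<and> K \<in> sets lebesgue \<and> diameter K \<le> \<sigma> * D \<and> R K \<in> polys (Suc m) \<and>
      (\<forall>q \<in> polys (Suc m).
        (LINT x|lebesgue_on K. R K x * q x + dderiv b (R K) x * dderiv b q x) =
        (LINT x|lebesgue_on K. g x * q x + h x * dderiv b q x))) \<longrightarrow>
    (\<Sum>K\<in>F. measure lebesgue K) \<le> measure lebesgue S \<longrightarrow>
    (\<Sum>K\<in>F. LINT x|lebesgue_on K. (R K x - g x)\<^sup>2 + (dderiv b (R K) x - h x)\<^sup>2)
      \<le> C * \<sigma>\<^sup>2 * ((LINT x|lebesgue_on S. (g x)\<^sup>2) + (LINT x|lebesgue_on S. (h x)\<^sup>2)))"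
    ..
  \<comment> \<open>C serves the first estimate; at least 1 is required where sigma exceeds 1 in the
    second.\<close>
  define C' where "C' = max C 1"
  show ?thesis
  proof (intro exI[of _ C'] conjI allI impI)
    fix \<Omega> :: "(real ^ 'n) set" and b c T0 split TT s T u w f K' R
    assume dpg: "transport_dpg \<Omega> b c T0 split TT s" and T: "T \<in> TT"
      and uw: "(u, w) \<in> trial_space mu mw b \<Omega> T" and f: "f \<in> broken_polys mf T" and K': "K' \<in> T"
      and R: "lifted_residual mv b c \<Omega> (s T) u w f R" and \<beta>: "inverse (norm b) \<le> \<beta>"
      and \<rho>: "shape_const TT \<le> \<rho>"
    interpret transport_dpg \<Omega> b c T0 split TT s by (rule dpg)
    let ?F = "cells_in (s T) K'" and ?\<sigma> = "subgrid_sigma TT s" and ?\<eta> = "(estimator b c K' u w f)\<^sup>2"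
    define E where "E = (\<Sum>K\<in>?F. (L2norm K (\<lambda>x. R x - (dderiv b w x + c x * u x - f x)))\<^sup>2
        + (L2norm K (\<lambda>x. dderiv b R x - (w x - u x)))\<^sup>2)"
    obtain g h p where g: "g \<in> polys (Suc m)" and h: "h \<in> polys m"
      and \<eta>: "?\<eta> = (LINT x|lebesgue_on K'. (g x)\<^sup>2) + (LINT x|lebesgue_on K'. (h x)\<^sup>2)"
      and p: "\<And>K. K \<in> ?F \<Longrightarrow> p K \<in> polys (Suc m)"
      and orth: "\<And>K q. K \<in> ?F \<Longrightarrow> q \<in> polys (Suc m) \<Longrightarrow>
        (LINT x|lebesgue_on K. p K x * q x + dderiv b (p K) x * dderiv b q x) =
        (LINT x|lebesgue_on K. g x * q x + h x * dderiv b q x)"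
      and err: "\<And>K. K \<in> ?F \<Longrightarrow> (L2norm K (\<lambda>x. R x - (dderiv b w x + c x * u x - f x)))\<^sup>2
        + (L2norm K (\<lambda>x. dderiv b R x - (w x - u x)))\<^sup>2 =
        (LINT x|lebesgue_on K. (p K x - g x)\<^sup>2 + (dderiv b (p K) x - h x)\<^sup>2)"
      and nrm: "\<And>K. K \<in> ?F \<Longrightarrow> (L2norm K R)\<^sup>2 + (L2norm K (dderiv b R))\<^sup>2 =
        (LINT x|lebesgue_on K. (p K x)\<^sup>2 + (dderiv b (p K) x)\<^sup>2)"
      using cellwise_projection[OF T K' uw f R[unfolded mv] deg] by blast
    have sT: "s T \<in> TT" using subgrid T by blast
    have sK': "int CARD('n) simplex K'" by (rule TT_simplex[OF T K'])
    have F: "K \<in> s T" "K \<subseteq> K'" "int CARD('n) simplex K" if "K \<in> ?F" for K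
      using that TT_simplex[OF sT] by (auto simp: cells_in_def)
    have finF: "finite ?F"
      using simplicial_partitionD(1)[OF subgrid_partition[OF T]] by (simp add: cells_in_def)
    have part: "(\<Sum>K\<in>?F. LINT x|lebesgue_on K. G x) = (LINT x|lebesgue_on K'. G x)"
      if "continuous_on UNIV G" for G :: "real ^ 'n \<Rightarrow> real"
      using finF F(3) simplicial_partitionD(3)[OF subgrid_partition[OF T] F(1) F(1)]
        Union_cells_in_subgrid[OF T K'] sK' that
      by (rule lebesgue_integral_partition)
    obtain x0 r where r: "r > 0" "ball x0 r \<subseteq> K'" "K' \<subseteq> cball x0 (diameter K')"
      "diameter K' > 0" "diameter K' \<le> M * r"
      unfolding M_def
      by (rule shape_ratio_inscribed_ball[OF sK' order_trans[OF shape_ratio_le[OF T K'] \<rho>]])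
    have \<sigma>: "diameter K' \<le> ?\<sigma>" by (rule subgrid_sigma_ge(1)[OF T K'])
    have \<sigma>0: "?\<sigma> > 0" using \<sigma> r(4) by simp
    \<comment> \<open>Additivity of the measure is the partition formula for the constant function
      1.\<close>
    have "(\<Sum>K\<in>?F. measure lebesgue K) = (\<Sum>K\<in>?F. LINT x|lebesgue_on K. 1)"
      by (intro sum.cong refl) (simp add: measure_restrict_space simplex_lebesgue(1)[OF F(3)])
    also have "\<dots> = measure lebesgue K'"
      by (subst part) (simp_all add: measure_restrict_space simplex_lebesgue(1)[OF sK'])
    finally have meas: "(\<Sum>K\<in>?F. measure lebesgue K) \<le> measure lebesgue K'" by simp
    have "(\<Sum>K\<in>?F. LINT x|lebesgue_on K. (p K x - g x)\<^sup>2 + (dderiv b (p K) x - h x)\<^sup>2)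
      \<le> C * ?\<sigma>\<^sup>2 * ((LINT x|lebesgue_on K'. (g x)\<^sup>2) + (LINT x|lebesgue_on K'. (h x)\<^sup>2))"
    proof (rule C[THEN conjunct2, rule_format, OF r(1,4,5,2,3) simplex_lebesgue(3,1)[OF sK'] b_nonzero _ \<sigma> g h _ meas])
      show "inverse (norm b) \<le> max \<beta> 1" using \<beta> by simp
      fix K assume K: "K \<in> ?F"
      have "diameter K \<le> ?\<sigma> * diameter K'"
        using subgrid_sigma_ge(2)[OF T K' K] r(4) by (simp add: divide_le_eq)
      moreover have "K \<noteq> {}" using full_simplex_interior_nonempty[OF F(3)[OF K]] by auto
      ultimately show "K \<subseteq> K' \<and> K \<noteq> {} \<and> K \<in> sets lebesgue \<and> diameter K \<le> ?\<sigma> * diameter K' \<and>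
        p K \<in> polys (Suc m) \<and> (\<forall>q \<in> polys (Suc m).
        (LINT x|lebesgue_on K. p K x * q x + dderiv b (p K) x * dderiv b q x) =
        (LINT x|lebesgue_on K. g x * q x + h x * dderiv b q x))"
        using F(2)[OF K] simplex_lebesgue(1)[OF F(3)[OF K]] p[OF K] orth[OF K] by blast
    qed
    then have E1: "E \<le> C * ?\<sigma>\<^sup>2 * ?\<eta>"
      unfolding E_def \<eta> using err by simp
    have "C * ?\<sigma>\<^sup>2 * ?\<eta> \<le> C' * ?\<sigma>\<^sup>2 * ?\<eta>"
      unfolding C'_def by (intro mult_right_mono) auto
    with E1 show "(\<Sum>K\<in>?F. (L2norm K (\<lambda>x. R x - (dderiv b w x + c x * u x - f x)))\<^sup>2
        + (L2norm K (\<lambda>x. dderiv b R x - (w x - u x)))\<^sup>2) \<le> C' * ?\<sigma>\<^sup>2 * ?\<eta>"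
      by (simp add: E_def)
    have Rsq: "(broken_norm b ?F R)\<^sup>2 = (\<Sum>K\<in>?F. (L2norm K R)\<^sup>2 + (L2norm K (dderiv b R))\<^sup>2)"
      unfolding broken_norm_def by (intro real_sqrt_pow2 sum_nonneg) simp
    also have "\<dots> = (\<Sum>K\<in>?F. (LINT x|lebesgue_on K. (g x)\<^sup>2 + (h x)\<^sup>2)
        - (LINT x|lebesgue_on K. (p K x - g x)\<^sup>2 + (dderiv b (p K) x - h x)\<^sup>2))"
    proof (intro sum.cong refl)
      fix K assume K: "K \<in> ?F"
      show "(L2norm K R)\<^sup>2 + (L2norm K (dderiv b R))\<^sup>2 = (LINT x|lebesgue_on K. (g x)\<^sup>2 + (h x)\<^sup>2)
        - (LINT x|lebesgue_on K. (p K x - g x)\<^sup>2 + (dderiv b (p K) x - h x)\<^sup>2)"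
        unfolding nrm[OF K]
        by (rule projection_identities(2)[OF simplex_lebesgue(2,1)[OF F(3)[OF K]] p[OF K] g h orth[OF K]])
    qed
    also have "\<dots> = (LINT x|lebesgue_on K'. (g x)\<^sup>2 + (h x)\<^sup>2) - E"
      unfolding sum_subtractf E_def using err
      by (subst part) (simp_all add: continuous_on_add continuous_on_power polys_continuous[OF g] polys_continuous[OF h])
    also have "(LINT x|lebesgue_on K'. (g x)\<^sup>2 + (h x)\<^sup>2) = ?\<eta>"
      unfolding \<eta> by (intro Bochner_Integration.integral_add integrable_lebesgue_on_bounded
          simplex_lebesgue(1,2)[OF sK'] continuous_intros polys_continuous[OF g] polys_continuous[OF h])
    finally have pyth: "(broken_norm b ?F R)\<^sup>2 = ?\<eta> - E" .
    have E0: "E \<ge> 0" unfolding E_def by (intro sum_nonneg) simp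
    \<comment> \<open>The squared norm of the residual is nonnegative, so the error cannot exceed
      the estimator.\<close>
    have E\<eta>: "E \<le> ?\<eta>" using pyth zero_le_power2[of "broken_norm b ?F R"] by linarith
    have "E \<le> C' * ?\<sigma> * ?\<eta>"
    \<comment> \<open>sigma also dominates diam K' and may exceed 1. Up to 1 its square is below it
      and the first estimate applies; beyond 1 the bound of E by the estimator takes over.\<close>
    proof (cases "?\<sigma> \<le> 1")
      case True
      then have "?\<sigma>\<^sup>2 \<le> ?\<sigma>" using \<sigma>0 by (simp add: power2_eq_square mult_le_one mult_left_le)
      then have "C * ?\<sigma>\<^sup>2 * ?\<eta> \<le> C' * ?\<sigma> * ?\<eta>"
        using \<sigma>0 unfolding C'_def by (intro mult_right_mono mult_mono) auto
      with E1 show ?thesis by linarith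
    next
      case False
      then have "1 * 1 \<le> C' * ?\<sigma>" unfolding C'_def by (intro mult_mono) auto
      then have "1 * ?\<eta> \<le> C' * ?\<sigma> * ?\<eta>" by (intro mult_right_mono) auto
      with E\<eta> show ?thesis by linarith
    qed
    then show "\<bar>(broken_norm b ?F R)\<^sup>2 - ?\<eta>\<bar> \<le> C' * ?\<sigma> * ?\<eta>"
      using pyth E0 by simp
  qed (simp add: C'_def)
qed

end
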